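(* Let $p\ge 3$ be a prime and let $L$ be a nilpotent finite dimensional Lie algebra over $\mathbb{F}_p$ of nilpotency class $c<p$. Let $P$ be the finite $p$-group corresponding to $L$ via the Lazard Correspondence, and let $\mathrm{L}(P)$ be the lattice of all subgroups of $P$. Then $$\mathrm{sd}(L)=\frac{|\{(H,K)\in \mathrm{L}(P)\times \mathrm{L}(P) \mid HK=KH\}|}{|\mathrm{L}(P)|^2},$$ that is, the subalgebra commutativity degree of $L$ equals the subgroup commutativity degree of $P$.
   Context: For a finite dimensional Lie algebra $L$ over a finite field, $\mathcal{L}(L)$ denotes the (finite) set of all Lie subalgebras of $L$, including $\{0\}$ and $L$. For $A,B\in\mathcal{L}(L)$, $A+B$ is the vector space sum and $[A,B]$ is the smallest Lie subalgebra of $L$ containing all brackets $[a,b]$ with $a\in A$, $b\in B$. The subalgebra commutativity degree of $L$ is $$\mathrm{sd}(L)=\frac{1}{|\mathcal{L}(L)|^2}\left|\{(A,B)\in\mathcal{L}(L)\times\mathcal{L}(L) \mid [A,B]\subseteq A+B\}\right|.$$ Lazard Correspondence: if $L$ is a Lie algebra over $\mathbb{F}_p$ of nilpotency class $c<p$, the corresponding group $P=P_L$ has the same underlying set as $L$ and group operation given by the Baker-Campbell-Hausdorff formula $$a*b=H(a,b)=a+b+\tfrac12[a,b]+\tfrac1{12}[a,[a,b]]-\tfrac1{12}[b,[a,b]]+\cdots,$$ where the brackets are Lie brackets of $L$; all terms of weight larger than $c$ vanish, and the rational coefficients of the terms of weight at most $c<p$ have denominators coprime to $p$, so the formula is a well-defined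 finite $\mathbb{F}_p$-linear combination of Lie monomials. $P_L$ is a finite $p$-group of exponent dividing $p$. For subgroups $H,K$ of $P$, $HK=\{hk\mid h\in H,k\in K\}$. *)

theory Defs
  imports Complex_Main "HOL-Library.Cardinality" "HOL-Algebra.Coset" "HOL-Computational_Algebra.Primes"
begin

locale lie_algebra = vector_space scale
  for scale :: "'k::field \<Rightarrow> 'l::ab_group_add \<Rightarrow> 'l" (infixr "*s" 75) +
  fixes bracket :: "'l \<Rightarrow> 'l \<Rightarrow> 'l" ("\<lbrace>_,/ _\<rbrace>")
  assumes linear_right: "Vector_Spaces.linear scale scale (\<lambda>y. \<lbrace>x, y\<rbrace>)"
    and linear_left: "Vector_Spaces.linear scale scale (\<lambda>x. \<lbrace>x, y\<rbrace>)"
    and bracket_self: "\<lbrace>x, x\<rbrace> = 0"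
    and jacobi: "\<lbrace>x, \<lbrace>y, z\<rbrace>\<rbrace> + \<lbrace>y, \<lbrace>z, x\<rbrace>\<rbrace> + \<lbrace>z, \<lbrace>x, y\<rbrace>\<rbrace> = 0"

text \<open>
  Index lists of weight \<open>w\<close> in Dynkin's form of the Baker--Campbell--Hausdorff series:
  sequences \<open>(r\<^sub>1, s\<^sub>1), \<dots>, (r\<^sub>n, s\<^sub>n)\<close> with \<open>r\<^sub>i + s\<^sub>i > 0\<close> and
  \<open>\<Sum>\<^sub>i (r\<^sub>i + s\<^sub>i) = w\<close>.
\<close>

definition dynkin_indices :: "nat \<Rightarrow> (nat \<times> nat) list set" where
  "dynkin_indices w =
     {ps. (\<forall>(r, s) \<in> set ps. r + s > 0) \<and> (\<Sum>(r, s)\<leftarrow>ps. r + s) = w}"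

lemma dynkin_indices_length: "ps \<in> dynkin_indices w \<Longrightarrow> length ps \<le> w"
proof (induction ps arbitrary: w)
  case (Cons q ps)
  obtain r s where q: "q = (r, s)" by (cases q)
  have "ps \<in> dynkin_indices (w - (r + s))" and "r + s > 0" "r + s \<le> w"
    using Cons.prems by (auto simp: q dynkin_indices_def)
  with Cons.IH[of "w - (r + s)"] show ?case
    unfolding length_Cons by linarith
qed simp

lemma finite_dynkin_indices: "finite (dynkin_indices w)"
proof (rule finite_subset)
  show "dynkin_indices w \<subseteq> {ps. set ps \<subseteq> {..w} \<times> {..w} \<and> length ps \<le> w}"
  proof
    fix ps assume ps: "ps \<in> dynkin_indices w"
    have "r \<le> w \<and> s \<le> w" if "(r, s) \<in> set ps" for r s
    proof -
      have "r + s \<in> set (map (\<lambda>(r, s). r + s) ps)" using that by force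
      then have "r + s \<le> (\<Sum>(r, s)\<leftarrow>ps. r + s)" by (intro member_le_sum_list) simp_all
      then show ?thesis using ps by (simp add: dynkin_indices_def)
    qed
    then show "ps \<in> {ps. set ps \<subseteq> {..w} \<times> {..w} \<and> length ps \<le> w}"
      using dynkin_indices_length[OF ps] by auto
  qed
  show "finite {ps. set ps \<subseteq> {..w} \<times> {..w} \<and> length ps \<le> w}"
    by (rule finite_lists_length_le) simp
qed

context lie_algebra
begin

definition lie_subalgebra :: "'l set \<Rightarrow> bool" where
  "lie_subalgebra A \<longleftrightarrow> subspace A \<and> (\<forall>x\<in>A. \<forall>y\<in>A. \<lbrace>x, y\<rbrace> \<in> A)"

definition bracket_subalgebra :: "'l set \<Rightarrow> 'l set \<Rightarrow> 'l set" where
  "bracket_subalgebra A B =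
     \<Inter>{S. lie_subalgebra S \<and> {\<lbrace>a, b\<rbrace> | a b. a \<in> A \<and> b \<in> B} \<subseteq> S}"

definition subalgebra_commutativity_degree :: real where
  "subalgebra_commutativity_degree =
     real (card {(A, B). lie_subalgebra A \<and> lie_subalgebra B \<and>
                         bracket_subalgebra A B \<subseteq> {a + b | a b. a \<in> A \<and> b \<in> B}})
     / (real (card {A. lie_subalgebra A}))\<^sup>2"

text \<open>The index is shifted: \<open>lower_central n\<close> is \<open>\<gamma>\<^bsub>n+1\<^esub>(L)\<close>, so class \<open>c\<close> means that
  \<open>c\<close> is least with \<open>lower_central c = 0\<close>.\<close>

primrec lower_central :: "nat \<Rightarrow> 'l set" where
  "lower_central 0 = UNIV"
| "lower_central (Suc n) = span {\<lbrace>x, y\<rbrace> | x y. y \<in> lower_central n}"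

definition nilpotent :: bool where
  "nilpotent \<longleftrightarrow> (\<exists>n. lower_central n = {0})"

definition nilpotency_class :: nat where
  "nilpotency_class = (LEAST n. lower_central n = {0})"

fun nested_bracket :: "'l list \<Rightarrow> 'l" where
  "nested_bracket [] = 0"
| "nested_bracket [x] = x"
| "nested_bracket (x # y # zs) = \<lbrace>x, nested_bracket (y # zs)\<rbrace>"

text \<open>
  The weight \<open>w\<close> component of the Baker--Campbell--Hausdorff series in Dynkin's form,
  the sum of
  \<open>(-1)\<^bsup>n-1\<^esup> / (n w r\<^sub>1! s\<^sub>1! \<cdots> r\<^sub>n! s\<^sub>n!) [x\<^bsup>r\<^sub>1\<^esup> y\<^bsup>s\<^sub>1\<^esup> \<cdots> x\<^bsup>r\<^sub>n\<^esup> y\<^bsup>s\<^sub>n\<^esup>]\<close>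
  with right-nested brackets. The prime factors of each denominator are at most \<open>w\<close>
  (as \<open>n \<le> w\<close> and \<open>r\<^sub>i, s\<^sub>i \<le> w\<close>), so the coefficients are meaningful in
  characteristic \<open>p > w\<close>.
\<close>

definition bch_component :: "nat \<Rightarrow> 'l \<Rightarrow> 'l \<Rightarrow> 'l" where
  "bch_component w x y =
     (\<Sum>ps \<in> dynkin_indices w.
        ((- 1) ^ (length ps - 1) /
           of_nat (length ps * w * (\<Prod>(r, s)\<leftarrow>ps. fact r * fact s)))
        *s nested_bracket (concat (map (\<lambda>(r, s). replicate r x @ replicate s y) ps)))"

definition bch :: "nat \<Rightarrow> 'l \<Rightarrow> 'l \<Rightarrow> 'l" where
  "bch c x y = (\<Sum>w = 1..c. bch_component w x y)"

text \<open>Components of weight above the nilpotency class vanish, so truncating there loses nothing.\<close>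

definition lazard_group :: "'l monoid" where
  "lazard_group = \<lparr>carrier = UNIV, monoid.mult = bch nilpotency_class, one = 0\<rparr>"

end

definition subgroup_commutativity_degree :: "('a, 'b) monoid_scheme \<Rightarrow> real" where
  "subgroup_commutativity_degree G =
     real (card {(H, K). subgroup H G \<and> subgroup K G \<and> H <#>\<^bsub>G\<^esub> K = K <#>\<^bsub>G\<^esub> H})
     / (real (card {H. subgroup H G}))\<^sup>2"

end

theory Submission
  imports Defs "HOL-Library.Product_Plus" "HOL-Library.Function_Algebras"
    "HOL-Computational_Algebra.Formal_Power_Series" "HOL-Number_Theory.Residues"
begin

text \<open>
  The main point is that Dynkin's series defines an associative operation on a Lie algebra \<open>L\<close> of
  class \<open>c < p\<close>. Adjoin the derivation \<open>D = t d/dt\<close> to \<open>L[[t]]\<close>. On elements \<open>a\<close> without constant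
  term, \<open>a \<mapsto> e\<^bsup>ad a\<^esup>(D)\<close> is injective and onto \<open>D + t L[[t]]\<close> up to degree \<open>c\<close>, because
  \<open>1, \<dots>, c\<close> are invertible; hence \<open>e\<^bsup>ad xt\<^esup> e\<^bsup>ad yt\<^esup> = e\<^bsup>ad b\<^esup>\<close> for a unique \<open>b\<close>. Applying the
  logarithm of this identity to \<open>D\<close> gives \<open>[b, D] = log (e\<^bsup>ad xt\<^esup> e\<^bsup>ad yt\<^esup>) D\<close>, which says that the
  coefficients of \<open>b\<close> are Dynkin's. At \<open>t = 1\<close> this reads \<open>e\<^bsup>ad x\<^esup> e\<^bsup>ad y\<^esup> = e\<^bsup>ad (x * y)\<^esup>\<close>.
  Using it for the extension of \<open>L\<close> by \<open>D\<close> in place of \<open>L\<close>, where \<open>a\<close> is recovered from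
  \<open>e\<^bsup>ad a\<^esup>(D)\<close>, gives associativity.

  Subgroups and Lie subalgebras are then the same sets. Since \<open>|AB| = |A| |B| / |A \<inter> B| = |A + B|\<close>,
  the condition \<open>AB = BA\<close> means that \<open>A + B\<close> is a subalgebra, that is, \<open>[A, B] \<subseteq> A + B\<close>.
\<close>

section \<open>Exponentials of nilpotent inner derivations\<close>

text \<open>Differentiating the truncated logarithm gives a geometric sum in \<open>1 - e\<close>
  times the derivative of \<open>e\<close>. Below degree \<open>c\<close> this agrees with
  \<open>1 - (1 - e) ^ c\<close>, hence with 1, and the invertibility of \<open>1, ..., c\<close>
  recovers the coefficients. This is log (exp X) = X in a form that survives positive
  characteristic.\<close>

lemma exp_log_series_nth:
  includes fps_syntax
  fixes c :: nat
  defines "e \<equiv> Abs_fps (\<lambda>n. inverse (of_nat (fact n))) :: 'k::field fps"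
  assumes inv: "\<And>n. 1 \<le> n \<Longrightarrow> n \<le> c \<Longrightarrow> (of_nat n :: 'k) \<noteq> 0"
    and "j \<le> c"
  shows "(\<Sum>m = 1..c. fps_const ((- 1) ^ (m - 1) / of_nat m) * (e - 1) ^ m) $ j
           = (if j = 1 then 1 else 0)"
proof -
  define l where "l = (\<Sum>m = 1..c. fps_const ((- 1) ^ (m - 1) / of_nat m) * (e - 1) ^ m)"
  have e0: "(1 - e) $ 0 = 0" by (simp add: e_def)
  have "fps_deriv l = (\<Sum>m = 1..c. (1 - e) ^ (m - 1) * fps_deriv e)"
    unfolding l_def fps_deriv_sum
  proof (rule sum.cong[OF refl])
    fix m assume m: "m \<in> {1..c}"
    then obtain q where q: "m = Suc q" by (cases m) auto
    have nz: "(of_nat (Suc q) :: 'k) \<noteq> 0" using inv[of m] m q by simp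
    have "fps_deriv (fps_const ((- 1) ^ (m - 1) / of_nat m) * (e - 1) ^ m)
        = fps_const ((- 1) ^ q / of_nat (Suc q)) * (fps_const (of_nat (Suc q)) * (fps_deriv e * (e - 1) ^ q))"
      by (simp add: q fps_deriv_power mult.assoc del: of_nat_Suc power_Suc)
    also have "\<dots> = fps_const ((- 1) ^ q / of_nat (Suc q) * of_nat (Suc q)) * (fps_deriv e * (e - 1) ^ q)"
      by (simp only: mult.assoc fps_const_mult[symmetric])
    also have "(- 1) ^ q / of_nat (Suc q) * of_nat (Suc q) = ((- 1) ^ q :: 'k)"
      using nz by (simp del: of_nat_Suc)
    also have "fps_const ((- 1) ^ q) = ((- 1) ^ q :: 'k fps)"
      by (simp add: fps_const_power[symmetric] fps_const_neg[symmetric] del: fps_const_power fps_const_neg)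
    also have "(- 1) ^ q * (fps_deriv e * (e - 1) ^ q) = (- 1 * (e - 1)) ^ q * fps_deriv e"
      by (simp only: power_mult_distrib mult_ac)
    finally show "fps_deriv (fps_const ((- 1) ^ (m - 1) / of_nat m) * (e - 1) ^ m)
        = (1 - e) ^ (m - 1) * fps_deriv e" by (simp add: q)
  qed
  also have "\<dots> = (\<Sum>i<c. (1 - e) ^ i) * fps_deriv e"
    by (simp add: sum_distrib_right sum.atLeast1_atMost_eq)
  finally have der: "fps_deriv l = (\<Sum>i<c. (1 - e) ^ i) * fps_deriv e" .
  \<comment> \<open>The bound matters: beyond degree \<open>c\<close> factorials may be 0 in the
    field, and \<open>inverse 0 = 0\<close> then cuts \<open>e\<close> off.\<close>
  have e': "fps_deriv e $ n = e $ n" if "n < c" for n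
  proof -
    have "(of_nat (fact (Suc n)) :: 'k) = of_nat (Suc n) * of_nat (fact n)"
      by (simp only: fact_Suc of_nat_mult of_nat_id)
    then show ?thesis
      using inv[of "Suc n"] that by (simp add: e_def del: of_nat_Suc fact_Suc)
  qed
  have l': "fps_deriv l $ n = (if n = 0 then 1 else 0)" if "n < c" for n
  proof -
    have "fps_deriv l $ n = ((\<Sum>i<c. (1 - e) ^ i) * e) $ n"
      unfolding der fps_mult_nth using that by (intro sum.cong refl) (subst e', auto)
    also have "(\<Sum>i<c. (1 - e) ^ i) * e = 1 - (1 - e) ^ c"
      using one_diff_power_eq[of "1 - e" c] by (simp add: mult.commute)
    also have "(1 - (1 - e) ^ c) $ n = (if n = 0 then 1 else 0)"
      using startsby_zero_power_prefix[OF e0] that by simp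
    finally show ?thesis .
  qed
  show ?thesis
  proof (cases j)
    case 0
    have "((e - 1) ^ m) $ 0 = 0" if "m \<ge> 1" for m
      using that by (intro startsby_zero_power) (simp_all add: e_def)
    then show ?thesis unfolding 0 fps_sum_nth by (intro trans[OF sum.neutral]) auto
  next
    case (Suc n)
    then have "of_nat (Suc n) * l $ Suc n = (if n = 0 then 1 else 0)"
      using l'[of n] \<open>j \<le> c\<close> by (simp del: of_nat_Suc)
    then have "l $ Suc n = (if n = 0 then 1 else 0)"
      using inv[of "Suc n"] Suc \<open>j \<le> c\<close> by (cases "n = 0") (auto simp del: of_nat_Suc simp add: of_nat_Suc[of 0])
    then show ?thesis using Suc by (simp add: l_def)
  qed
qed

section \<open>Bracket identities and powers of inner derivations\<close>

context lie_algebra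
begin

lemma bracket_add_right: "\<lbrace>x, y + z\<rbrace> = \<lbrace>x, y\<rbrace> + \<lbrace>x, z\<rbrace>"
  and bracket_scale_right: "\<lbrace>x, r *s y\<rbrace> = r *s \<lbrace>x, y\<rbrace>"
  and bracket_add_left: "\<lbrace>y + z, x\<rbrace> = \<lbrace>y, x\<rbrace> + \<lbrace>z, x\<rbrace>"
  and bracket_scale_left: "\<lbrace>r *s y, x\<rbrace> = r *s \<lbrace>y, x\<rbrace>"
  using linear_right[of x] linear_left[of x]
  by (simp_all add: Vector_Spaces.linear_def module_hom_def module_hom_axioms_def)

lemma bracket_zero_right [simp]: "\<lbrace>x, 0\<rbrace> = 0"
  using bracket_add_right[of x 0 0] by simp

lemma bracket_zero_left [simp]: "\<lbrace>0, x\<rbrace> = 0"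
  using bracket_add_left[of 0 0 x] by simp

lemma bracket_minus_right: "\<lbrace>x, - y\<rbrace> = - \<lbrace>x, y\<rbrace>"
  using bracket_add_right[of x y "- y"] by (simp add: eq_neg_iff_add_eq_0 add.commute)

lemma bracket_minus_left: "\<lbrace>- x, y\<rbrace> = - \<lbrace>x, y\<rbrace>"
  using bracket_add_left[of x "- x" y] by (simp add: eq_neg_iff_add_eq_0 add.commute)

lemma bracket_diff_right: "\<lbrace>x, y - z\<rbrace> = \<lbrace>x, y\<rbrace> - \<lbrace>x, z\<rbrace>"
  using bracket_add_right[of x y "- z"] by (simp add: bracket_minus_right)

lemma bracket_diff_left: "\<lbrace>x - z, y\<rbrace> = \<lbrace>x, y\<rbrace> - \<lbrace>z, y\<rbrace>"
  using bracket_add_left[of x "- z" y] by (simp add: bracket_minus_left)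

lemma bracket_sum_right: "\<lbrace>x, \<Sum>i\<in>I. f i\<rbrace> = (\<Sum>i\<in>I. \<lbrace>x, f i\<rbrace>)"
  by (induction I rule: infinite_finite_induct) (simp_all add: bracket_add_right)

lemma bracket_sum_left: "\<lbrace>\<Sum>i\<in>I. f i, x\<rbrace> = (\<Sum>i\<in>I. \<lbrace>f i, x\<rbrace>)"
  by (induction I rule: infinite_finite_induct) (simp_all add: bracket_add_left)

lemma bracket_antisym: "\<lbrace>x, y\<rbrace> = - \<lbrace>y, x\<rbrace>"
proof -
  have "0 = \<lbrace>x + y, x + y\<rbrace>" by (simp add: bracket_self)
  also have "\<dots> = \<lbrace>x, y\<rbrace> + \<lbrace>y, x\<rbrace>"
    by (simp add: bracket_add_left bracket_add_right bracket_self[of x] bracket_self[of y])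
  finally show ?thesis by (metis eq_neg_iff_add_eq_0)
qed

lemma bracket_leibniz: "\<lbrace>x, \<lbrace>y, z\<rbrace>\<rbrace> = \<lbrace>\<lbrace>x, y\<rbrace>, z\<rbrace> + \<lbrace>y, \<lbrace>x, z\<rbrace>\<rbrace>"
proof -
  have "\<lbrace>y, \<lbrace>z, x\<rbrace>\<rbrace> = - \<lbrace>y, \<lbrace>x, z\<rbrace>\<rbrace>" "\<lbrace>z, \<lbrace>x, y\<rbrace>\<rbrace> = - \<lbrace>\<lbrace>x, y\<rbrace>, z\<rbrace>"
    using bracket_antisym[of z x] bracket_antisym[of z "\<lbrace>x, y\<rbrace>"] by (simp_all add: bracket_minus_right)
  then show ?thesis using jacobi[of x y z] by (simp add: algebra_simps)
qed

lemma ad_power_add: "(bracket x ^^ k) (y + z) = (bracket x ^^ k) y + (bracket x ^^ k) z"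
  by (induction k) (simp_all add: bracket_add_right)

lemma ad_power_scale: "(bracket x ^^ k) (r *s y) = r *s (bracket x ^^ k) y"
  by (induction k) (simp_all add: bracket_scale_right)

lemma ad_power_zero [simp]: "(bracket x ^^ k) 0 = 0"
  by (induction k) simp_all

lemma ad_power_sum: "(bracket x ^^ k) (\<Sum>i\<in>I. f i) = (\<Sum>i\<in>I. (bracket x ^^ k) (f i))"
  by (induction I rule: infinite_finite_induct) (simp_all add: ad_power_add)

text \<open>Higher Leibniz rule for the derivation \<open>bracket x\<close>; the induction step is
  Pascal's rule once both sums share an index.\<close>

lemma ad_power_bracket:
  "(bracket x ^^ n) \<lbrace>y, z\<rbrace>
    = (\<Sum>k\<le>n. of_nat (n choose k) *s \<lbrace>(bracket x ^^ k) y, (bracket x ^^ (n - k)) z\<rbrace>)"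
proof (induction n)
  case (Suc n)
  let ?b = "\<lambda>i j. \<lbrace>(bracket x ^^ i) y, (bracket x ^^ j) z\<rbrace>"
  have "(bracket x ^^ Suc n) \<lbrace>y, z\<rbrace>
      = (\<Sum>k\<le>n. of_nat (n choose k) *s (?b (Suc k) (n - k) + ?b k (Suc (n - k))))"
    by (simp add: Suc bracket_sum_right bracket_scale_right bracket_leibniz[of x])
  also have "\<dots> = (\<Sum>k\<le>n. of_nat (n choose k) *s ?b (Suc k) (n - k))
      + (\<Sum>k\<le>n. of_nat (n choose k) *s ?b k (Suc n - k))"
    by (simp add: scale_right_distrib sum.distrib Suc_diff_le)
  also have "(\<Sum>k\<le>n. of_nat (n choose k) *s ?b k (Suc n - k))
      = (\<Sum>k\<le>Suc n. of_nat (n choose k) *s ?b k (Suc n - k))"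
    by (simp add: binomial_eq_0)
  also have "\<dots> = ?b 0 (Suc n) + (\<Sum>k\<le>n. of_nat (n choose Suc k) *s ?b (Suc k) (n - k))"
    by (subst sum.atMost_Suc_shift) simp
  also have "(\<Sum>k\<le>n. of_nat (n choose k) *s ?b (Suc k) (n - k)) + \<dots>
      = ?b 0 (Suc n) + (\<Sum>k\<le>n. of_nat (Suc n choose Suc k) *s ?b (Suc k) (n - k))"
    by (simp add: sum.distrib scale_left_distrib algebra_simps)
  also have "\<dots> = (\<Sum>k\<le>Suc n. of_nat (Suc n choose k) *s ?b k (Suc n - k))"
    by (subst sum.atMost_Suc_shift) simp
  finally show ?case .
qed simp

end

text \<open>A filtration instead of nilpotency lets the same results apply to \<open>L\<close>, to
  the filtration generated by a subset \<open>H\<close>, and to the extension by \<open>D\<close>.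
  Only elements of \<open>F 1\<close> are exponentiated; \<open>F 0\<close> may contain elements
  such as \<open>D\<close>, whose inner derivation need not be nilpotent.\<close>

locale filtered_lie_algebra = lie_algebra scale bracket
  for scale :: "'k::field \<Rightarrow> 'l::ab_group_add \<Rightarrow> 'l" (infixr "*s" 75)
    and bracket :: "'l \<Rightarrow> 'l \<Rightarrow> 'l" ("\<lbrace>_,/ _\<rbrace>") +
  fixes F :: "nat \<Rightarrow> 'l set" and c :: nat
  assumes F_subspace: "subspace (F n)"
    and F_Suc: "F (Suc n) \<subseteq> F n"
    and F_bracket: "x \<in> F i \<Longrightarrow> y \<in> F j \<Longrightarrow> \<lbrace>x, y\<rbrace> \<in> F (i + j)"
    and F_Suc_c: "F (Suc c) = {0}"
    and of_nat_nonzero: "1 \<le> n \<Longrightarrow> n \<le> c \<Longrightarrow> (of_nat n :: 'k) \<noteq> 0"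
begin

lemma F_antimono: "i \<le> j \<Longrightarrow> F j \<subseteq> F i"
  using lift_Suc_antimono_le[of F i j] F_Suc by blast

lemma F_weaken: "x \<in> F j \<Longrightarrow> i \<le> j \<Longrightarrow> x \<in> F i"
  using F_antimono by blast

lemma F_zero [simp, intro]: "0 \<in> F n"
  and F_add: "x \<in> F n \<Longrightarrow> y \<in> F n \<Longrightarrow> x + y \<in> F n"
  and F_diff: "x \<in> F n \<Longrightarrow> y \<in> F n \<Longrightarrow> x - y \<in> F n"
  and F_neg: "x \<in> F n \<Longrightarrow> - x \<in> F n"
  and F_scale: "x \<in> F n \<Longrightarrow> r *s x \<in> F n"
  and F_sum: "(\<And>i. i \<in> I \<Longrightarrow> f i \<in> F n) \<Longrightarrow> (\<Sum>i\<in>I. f i) \<in> F n"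
  using F_subspace[of n]
  by (auto intro: subspace_0 subspace_add subspace_diff subspace_neg subspace_scale subspace_sum)

lemma F_vanish: "x \<in> F n \<Longrightarrow> n > c \<Longrightarrow> x = 0"
  using F_weaken[of x n "Suc c"] F_Suc_c by auto

lemma F_bracket_left: "x \<in> F 1 \<Longrightarrow> y \<in> F n \<Longrightarrow> \<lbrace>x, y\<rbrace> \<in> F (Suc n)"
  using F_bracket[of x 1 y n] by simp

lemma of_nat_fact_nonzero: "n \<le> c \<Longrightarrow> (of_nat (fact n) :: 'k) \<noteq> 0"
proof (induction n)
  case (Suc n)
  then show ?case using of_nat_nonzero[of "Suc n"] by (simp only: fact_Suc of_nat_mult of_nat_id mult_eq_0_iff) simp
qed simp

lemma ad_power_in_F: "x \<in> F 1 \<Longrightarrow> z \<in> F i \<Longrightarrow> (bracket x ^^ k) z \<in> F (k + i)"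
  by (induction k) (simp_all add: F_bracket_left)

text \<open>Stopping at \<open>c\<close> loses nothing for \<open>x\<close> in \<open>F 1\<close>
  and \<open>z\<close> in \<open>F 0\<close>: the later powers land in \<open>F (Suc c)\<close>. The
  factorials up to \<open>c\<close> are invertible.\<close>

definition exp_ad :: "'l \<Rightarrow> 'l \<Rightarrow> 'l" where
  "exp_ad x z = (\<Sum>k\<le>c. inverse (of_nat (fact k)) *s (bracket x ^^ k) z)"

lemma exp_ad_add: "exp_ad x (y + z) = exp_ad x y + exp_ad x z"
  by (simp add: exp_ad_def ad_power_add scale_right_distrib sum.distrib)

lemma exp_ad_scale: "exp_ad x (r *s y) = r *s exp_ad x y"
  by (simp add: exp_ad_def ad_power_scale scale_sum_right mult.commute)

lemma exp_ad_zero_right [simp]: "exp_ad x 0 = 0"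
  by (simp add: exp_ad_def)

lemma exp_ad_sum: "exp_ad x (\<Sum>i\<in>I. f i) = (\<Sum>i\<in>I. exp_ad x (f i))"
  by (induction I rule: infinite_finite_induct) (simp_all add: exp_ad_add)

lemma exp_ad_minus_self_in_F:
  assumes "x \<in> F 1" "z \<in> F i"
  shows "exp_ad x z - z \<in> F (Suc i)"
proof -
  have "exp_ad x z - z = (\<Sum>k<c. inverse (of_nat (fact (Suc k))) *s (bracket x ^^ Suc k) z)"
    unfolding exp_ad_def by (subst sum.atMost_shift) simp
  also have "\<dots> \<in> F (Suc i)"
    by (intro F_sum F_scale) (rule F_weaken[OF ad_power_in_F[OF assms]], simp)
  finally show ?thesis .
qed

lemma exp_ad_in_F: "x \<in> F 1 \<Longrightarrow> z \<in> F i \<Longrightarrow> exp_ad x z \<in> F i"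
  using F_add[of "exp_ad x z - z" i z] F_weaken[OF exp_ad_minus_self_in_F, of x z i i] by simp

text \<open>The exponential of a nilpotent derivation is an automorphism. Products of weight above
  \<open>c\<close> vanish by the filtration, so the square of indices shrinks to a triangle, whose
  diagonals are given by the Leibniz rule.\<close>

lemma exp_ad_bracket:
  assumes x: "x \<in> F 1" and y: "y \<in> F 0" and z: "z \<in> F 0"
  shows "exp_ad x \<lbrace>y, z\<rbrace> = \<lbrace>exp_ad x y, exp_ad x z\<rbrace>"
proof -
  let ?t = "\<lambda>i j. (inverse (of_nat (fact i)) * inverse (of_nat (fact j)))
                    *s \<lbrace>(bracket x ^^ i) y, (bracket x ^^ j) z\<rbrace>"
  have zero: "?t i j = 0" if "i + j > c" for i j
    using F_vanish[OF F_bracket[OF ad_power_in_F[OF x y] ad_power_in_F[OF x z]]] that by simp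
  have "\<lbrace>exp_ad x y, exp_ad x z\<rbrace> = (\<Sum>i\<le>c. \<Sum>j\<le>c. ?t i j)"
    unfolding exp_ad_def bracket_sum_left
    by (simp add: bracket_sum_right bracket_scale_left bracket_scale_right scale_sum_right mult.commute)
  also have "\<dots> = (\<Sum>(i, j)\<in>{..c} \<times> {..c}. ?t i j)"
    by (simp add: sum.cartesian_product)
  also have "\<dots> = (\<Sum>(i, j)\<in>{(i, j). i + j \<le> c}. ?t i j)"
    by (rule sum.mono_neutral_right) (use zero in \<open>auto intro: leI simp del: scale_eq_0_iff\<close>)
  also have "\<dots> = (\<Sum>n\<le>c. \<Sum>i\<le>n. ?t i (n - i))"
    using sum.triangle_reindex_eq[of ?t c] by simp
  also have "\<dots> = (\<Sum>n\<le>c. inverse (of_nat (fact n)) *s (bracket x ^^ n) \<lbrace>y, z\<rbrace>)"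
  proof (rule sum.cong[OF refl])
    fix n assume n: "n \<in> {..c}"
    have "(inverse (of_nat (fact i)) * inverse (of_nat (fact (n - i))) :: 'k)
        = inverse (of_nat (fact n)) * of_nat (n choose i)" if "i \<le> n" for i
    proof -
      have "of_nat (fact n) = (of_nat (fact i) * of_nat (fact (n - i)) * of_nat (n choose i) :: 'k)"
        using binomial_fact_lemma[OF that] by (metis of_nat_mult)
      moreover have "(of_nat (fact n) :: 'k) \<noteq> 0" using of_nat_fact_nonzero n by simp
      ultimately show ?thesis by (simp add: field_simps)
    qed
    then show "(\<Sum>i\<le>n. ?t i (n - i)) = inverse (of_nat (fact n)) *s (bracket x ^^ n) \<lbrace>y, z\<rbrace>"
      by (simp add: ad_power_bracket scale_sum_right)
  qed
  finally show ?thesis by (simp add: exp_ad_def)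
qed

lemma ad_power_perturb:
  assumes x: "x \<in> F 1" and d: "d \<in> F n" and "n \<ge> 1" and z: "z \<in> F 0"
  shows "(bracket (x + d) ^^ Suc k) z - (bracket x ^^ Suc k) z \<in> F (n + k)"
proof (induction k)
  case 0
  show ?case using F_bracket[OF d z] by (simp add: bracket_add_left)
next
  case (Suc k)
  have d1: "d \<in> F 1" using d F_weaken \<open>n \<ge> 1\<close> by blast
  have "(bracket (x + d) ^^ Suc (Suc k)) z - (bracket x ^^ Suc (Suc k)) z
      = \<lbrace>x + d, (bracket (x + d) ^^ Suc k) z - (bracket x ^^ Suc k) z\<rbrace> + \<lbrace>d, (bracket x ^^ Suc k) z\<rbrace>"
    by (simp add: bracket_add_left bracket_diff_right)
  moreover have "\<lbrace>x + d, (bracket (x + d) ^^ Suc k) z - (bracket x ^^ Suc k) z\<rbrace> \<in> F (n + Suc k)"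
    using F_bracket_left[OF F_add[OF x d1] Suc] by simp
  moreover have "\<lbrace>d, (bracket x ^^ Suc k) z\<rbrace> \<in> F (n + Suc k)"
    using F_bracket[OF d ad_power_in_F[OF x z, of "Suc k"]] by simp
  ultimately show ?case using F_add by metis
qed

text \<open>First-order variation of the exponential: the change in a second or higher power of
  \<open>bracket x\<close> contains \<open>d\<close> and at least one further factor from
  \<open>F 1\<close>, so it lies one level deeper. It drives the successive approximations
  below.\<close>

lemma exp_ad_perturb:
  assumes x: "x \<in> F 1" and d: "d \<in> F n" and "n \<ge> 1" and z: "z \<in> F 0"
  shows "exp_ad (x + d) z - exp_ad x z - \<lbrace>d, z\<rbrace> \<in> F (Suc n)"
proof (cases "c = 0")
  case True
  then have "\<lbrace>d, z\<rbrace> = 0" using F_vanish[OF F_bracket[OF d z]] \<open>n \<ge> 1\<close> by simp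
  then show ?thesis unfolding exp_ad_def using True by simp
next
  case False
  then obtain b where b: "c = Suc b" by (cases c) auto
  let ?d = "\<lambda>k. (bracket (x + d) ^^ k) z - (bracket x ^^ k) z"
  have "exp_ad (x + d) z - exp_ad x z = (\<Sum>k\<le>c. inverse (of_nat (fact k)) *s ?d k)"
    by (simp add: exp_ad_def sum_subtractf scale_right_diff_distrib)
  also have "\<dots> = \<lbrace>d, z\<rbrace> + (\<Sum>k<b. inverse (of_nat (fact (Suc (Suc k)))) *s ?d (Suc (Suc k)))"
    unfolding b by (subst sum.atMost_Suc_shift, subst sum.atMost_shift) (simp add: bracket_add_left del: fact_Suc)
  finally have "exp_ad (x + d) z - exp_ad x z - \<lbrace>d, z\<rbrace>
      = (\<Sum>k<b. inverse (of_nat (fact (Suc (Suc k)))) *s ?d (Suc (Suc k)))" by simp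
  also have "\<dots> \<in> F (Suc n)"
    by (intro F_sum F_scale)
      (rule F_weaken[OF ad_power_perturb[OF assms]], simp)
  finally show ?thesis .
qed

definition fps_ad :: "'k fps \<Rightarrow> 'l \<Rightarrow> 'l \<Rightarrow> 'l" where
  "fps_ad f x z = (\<Sum>j\<le>c. fps_nth f j *s (bracket x ^^ j) z)"

text \<open>Substituting \<open>bracket x\<close> into power series respects products because powers
  above \<open>c\<close> kill \<open>F 0\<close>. Identities of formal series thus become identities
  of operators.\<close>

lemma fps_ad_mult:
  assumes x: "x \<in> F 1" and z: "z \<in> F 0"
  shows "fps_ad (f * g) x z = fps_ad f x (fps_ad g x z)"
proof -
  let ?t = "\<lambda>i j. (fps_nth f i * fps_nth g j) *s (bracket x ^^ (i + j)) z"
  have zero: "?t i j = 0" if "i + j > c" for i j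
    using F_vanish[OF ad_power_in_F[OF x z]] that by simp
  have "fps_ad f x (fps_ad g x z) = (\<Sum>i\<le>c. \<Sum>j\<le>c. ?t i j)"
    by (simp add: fps_ad_def ad_power_sum ad_power_scale scale_sum_right funpow_add)
  also have "\<dots> = (\<Sum>(i, j)\<in>{..c} \<times> {..c}. ?t i j)"
    by (simp add: sum.cartesian_product)
  also have "\<dots> = (\<Sum>(i, j)\<in>{(i, j). i + j \<le> c}. ?t i j)"
    by (rule sum.mono_neutral_right) (use zero in \<open>auto intro: leI simp del: scale_eq_0_iff\<close>)
  also have "\<dots> = (\<Sum>n\<le>c. \<Sum>i\<le>n. ?t i (n - i))"
    using sum.triangle_reindex_eq[of ?t c] by simp
  also have "\<dots> = fps_ad (f * g) x z"
    by (simp add: fps_ad_def fps_mult_nth scale_sum_left atMost_atLeast0)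
  finally show ?thesis by simp
qed

lemma log_exp_ad:
  assumes x: "x \<in> F 1" and z: "z \<in> F 0"
  shows "(\<Sum>m = 1..c. ((- 1) ^ (m - 1) / of_nat m) *s ((\<lambda>z. exp_ad x z - z) ^^ m) z) = \<lbrace>x, z\<rbrace>"
proof -
  define e where "e = (Abs_fps (\<lambda>n. inverse (of_nat (fact n))) :: 'k fps)"
  have one: "fps_ad 1 x z = z" for z
  proof -
    have "fps_ad 1 x z = (\<Sum>j\<in>{0}. fps_nth 1 j *s (bracket x ^^ j) z)"
      unfolding fps_ad_def by (rule sum.mono_neutral_right) auto
    then show ?thesis by simp
  qed
  have E: "exp_ad x z - z = fps_ad (e - 1) x z" for z
    using one[of z] by (simp add: exp_ad_def e_def fps_ad_def scale_left_diff_distrib sum_subtractf)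
  have pow: "((\<lambda>z. exp_ad x z - z) ^^ m) z = fps_ad ((e - 1) ^ m) x z" for m
  proof (induction m)
    case 0
    show ?case by (simp add: one)
  next
    case (Suc m)
    then show ?case by (simp add: E fps_ad_mult[OF x z])
  qed
  let ?l = "\<Sum>m = 1..c. fps_const ((- 1) ^ (m - 1) / of_nat m) * (e - 1) ^ m"
  have "(\<Sum>m = 1..c. ((- 1) ^ (m - 1) / of_nat m) *s ((\<lambda>z. exp_ad x z - z) ^^ m) z)
      = fps_ad ?l x z"
    unfolding pow fps_ad_def fps_sum_nth fps_mult_left_const_nth scale_sum_right scale_sum_left
    by (subst sum.swap) simp
  also have "\<dots> = (\<Sum>j\<le>c. if j = 1 then \<lbrace>x, z\<rbrace> else 0)"
    unfolding fps_ad_def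
    using exp_log_series_nth[OF of_nat_nonzero, of c] by (intro sum.cong) (auto simp: e_def)
  \<comment> \<open>For \<open>c = 0\<close> the sum has no term with \<open>j = 1\<close>, but then
    the bracket is 0 as well.\<close>
  also have "\<dots> = \<lbrace>x, z\<rbrace>"
    using F_vanish[OF F_bracket[OF x z]] by (auto simp: not_le)
  finally show ?thesis .
qed

end

section \<open>Words and the logarithm of a product of exponentials\<close>

abbreviation bch_word :: "'a \<Rightarrow> 'a \<Rightarrow> (nat \<times> nat) list \<Rightarrow> 'a list" where
  "bch_word x y ps \<equiv> concat (map (\<lambda>(r, s). replicate r x @ replicate s y) ps)"

lemma length_bch_word: "length (bch_word x y ps) = (\<Sum>(r, s)\<leftarrow>ps. r + s)"
  by (induction ps) auto

lemma length_bch_word_dynkin: "ps \<in> dynkin_indices w \<Longrightarrow> length (bch_word x y ps) = w"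
  unfolding length_bch_word by (simp add: dynkin_indices_def)

lemma map_bch_word: "map h (bch_word x y ps) = bch_word (h x) (h y) ps"
  by (induction ps) auto

lemma set_bch_word: "set (bch_word x y ps) \<subseteq> {x, y}"
proof (induction ps)
  case (Cons q ps)
  then show ?case
    using [[simproc del: list_to_set_comprehension]]
    by (cases q) (simp add: set_replicate_conv_if)
qed simp

context lie_algebra
begin

lemma foldr_bracket_replicate: "foldr bracket (replicate r x) z = (bracket x ^^ r) z"
  by (induction r) simp_all

lemma foldr_bracket_bch_word_Cons:
  "foldr bracket (bch_word x y ((r, s) # ps)) z
    = (bracket x ^^ r) ((bracket y ^^ s) (foldr bracket (bch_word x y ps) z))"
  by (simp add: foldr_bracket_replicate)

end

context filtered_lie_algebra
begin

lemma foldr_bracket_in_F: "set ws \<subseteq> F 1 \<Longrightarrow> z \<in> F 0 \<Longrightarrow> foldr bracket ws z \<in> F (length ws)"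
  by (induction ws) (simp_all add: F_bracket_left)

definition dynkin_weight :: "(nat \<times> nat) list \<Rightarrow> 'k" where
  "dynkin_weight ps = inverse (of_nat (\<Prod>(r, s)\<leftarrow>ps. fact r * fact s))"

text \<open>Each factor is a sum over blocks \<open>(r, s)\<close>, the identity being the block
  \<open>(0, 0)\<close> that is subtracted; a product of \<open>m\<close> factors is therefore a sum
  over lists of \<open>m\<close> blocks. The bound \<open>c\<close> on the exponents comes from the
  truncation in \<open>exp_ad\<close>.\<close>

lemma exp_ad_exp_ad_power:
  assumes x: "x \<in> F 1" and y: "y \<in> F 1" and z: "z \<in> F 0"
  shows "((\<lambda>z. exp_ad x (exp_ad y z) - z) ^^ m) z
    = (\<Sum>ps\<in>{ps. set ps \<subseteq> {..c} \<times> {..c} - {(0, 0)} \<and> length ps = m}.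
        dynkin_weight ps *s foldr bracket (bch_word x y ps) z)"
proof (induction m)
  case 0
  have "{ps :: (nat \<times> nat) list. set ps \<subseteq> {..c} \<times> {..c} - {(0, 0)} \<and> length ps = 0} = {[]}" by auto
  then show ?case by (simp add: dynkin_weight_def)
next
  case (Suc m)
  let ?P = "{..c} \<times> {..c} - {(0, 0)} :: (nat \<times> nat) set"
  let ?A = "{ps. set ps \<subseteq> ?P \<and> length ps = m}"
  let ?T = "\<lambda>z. exp_ad x (exp_ad y z) - z"
  let ?g = "\<lambda>r s. inverse (of_nat (fact r)) * inverse (of_nat (fact s)) :: 'k"
  have T: "?T v = (\<Sum>(r, s)\<in>?P. ?g r s *s (bracket x ^^ r) ((bracket y ^^ s) v))" for v
  proof -
    have "exp_ad x (exp_ad y v)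
        = (\<Sum>(r, s)\<in>{..c} \<times> {..c}. ?g r s *s (bracket x ^^ r) ((bracket y ^^ s) v))"
      by (simp add: exp_ad_def ad_power_sum ad_power_scale scale_sum_right sum.cartesian_product)
    also have "\<dots> = v + (\<Sum>(r, s)\<in>?P. ?g r s *s (bracket x ^^ r) ((bracket y ^^ s) v))"
      by (subst sum.remove[where x = "(0, 0)"]) simp_all
    finally show ?thesis by simp
  qed
  have T_sum: "?T (\<Sum>i\<in>I. a i *s f i) = (\<Sum>i\<in>I. a i *s ?T (f i))" for I and a :: "_ \<Rightarrow> 'k" and f
    by (simp add: exp_ad_sum exp_ad_scale sum_subtractf scale_right_diff_distrib)
  have w: "dynkin_weight ((r, s) # ps) = dynkin_weight ps * ?g r s" for r s ps
    by (simp add: dynkin_weight_def mult_ac)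
  have "(?T ^^ Suc m) z = (\<Sum>ps\<in>?A. dynkin_weight ps *s ?T (foldr bracket (bch_word x y ps) z))"
    using Suc T_sum by simp
  also have "\<dots> = (\<Sum>ps\<in>?A. \<Sum>(r, s)\<in>?P. dynkin_weight ((r, s) # ps)
                 *s foldr bracket (bch_word x y ((r, s) # ps)) z)"
    by (simp only: T scale_sum_right foldr_bracket_bch_word_Cons w)
      (simp add: case_prod_unfold scale_sum_right)
  also have "\<dots> = (\<Sum>(ps, q)\<in>?A \<times> ?P. dynkin_weight (q # ps) *s foldr bracket (bch_word x y (q # ps)) z)"
    by (simp add: sum.cartesian_product case_prod_unfold)
  also have "\<dots> = (\<Sum>ps\<in>(\<lambda>(ps, q). q # ps) ` (?A \<times> ?P). dynkin_weight ps *s foldr bracket (bch_word x y ps) z)"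
    by (subst sum.reindex) (auto simp: inj_on_def case_prod_unfold intro!: sum.cong)
  also have "(\<lambda>(ps, q). q # ps) ` (?A \<times> ?P) = {ps. set ps \<subseteq> ?P \<and> length ps = Suc m}"
    by (rule lists_length_Suc_eq[symmetric])
  finally show ?case .
qed

text \<open>Regrouping by weight instead of by number of blocks. Lists of weight
  \<open>1, ..., c\<close> have length and entries at most \<open>c\<close>, so they all occur; the
  remaining lists have weight above \<open>c\<close> and their words act as 0. Compared with
  Dynkin's coefficients the factor \<open>w\<close> in the denominator is still missing.\<close>

lemma log_exp_ad_exp_ad:
  assumes x: "x \<in> F 1" and y: "y \<in> F 1" and z: "z \<in> F 0"
  shows "(\<Sum>m = 1..c. ((- 1) ^ (m - 1) / of_nat m) *s ((\<lambda>z. exp_ad x (exp_ad y z) - z) ^^ m) z)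
    = (\<Sum>w = 1..c. \<Sum>ps\<in>dynkin_indices w.
        ((- 1) ^ (length ps - 1) / of_nat (length ps * (\<Prod>(r, s)\<leftarrow>ps. fact r * fact s)))
          *s foldr bracket (bch_word x y ps) z)"
proof -
  let ?P = "{..c} \<times> {..c} - {(0, 0)} :: (nat \<times> nat) set"
  let ?A = "\<lambda>m. {ps. set ps \<subseteq> ?P \<and> length ps = m}"
  define g where "g ps = ((- 1) ^ (length ps - 1) / of_nat (length ps * (\<Prod>(r, s)\<leftarrow>ps. fact r * fact s)))
          *s foldr bracket (bch_word x y ps) z" for ps
  have finA: "finite (?A m)" for m by (rule finite_lists_length_eq) simp
  have "(\<Sum>m = 1..c. ((- 1) ^ (m - 1) / of_nat m) *s ((\<lambda>z. exp_ad x (exp_ad y z) - z) ^^ m) z)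
      = (\<Sum>m = 1..c. \<Sum>ps\<in>?A m. g ps)"
    unfolding exp_ad_exp_ad_power[OF assms] scale_sum_right
    by (intro sum.cong refl) (simp add: g_def dynkin_weight_def divide_inverse mult_ac)
  also have "\<dots> = (\<Sum>ps\<in>(\<Union>m\<in>{1..c}. ?A m). g ps)"
    by (rule sum.UNION_disjoint[symmetric]) (auto simp: finA)
  also have "\<dots> = (\<Sum>ps\<in>(\<Union>w\<in>{1..c}. dynkin_indices w). g ps)"
  proof (rule sum.mono_neutral_right)
    show "finite (\<Union>m\<in>{1..c}. ?A m)" using finA by blast
    show "(\<Union>w\<in>{1..c}. dynkin_indices w) \<subseteq> (\<Union>m\<in>{1..c}. ?A m)"
    proof
      fix ps assume "ps \<in> (\<Union>w\<in>{1..c}. dynkin_indices w)"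
      then obtain w where w: "1 \<le> w" "w \<le> c" "ps \<in> dynkin_indices w" by auto
      have "r \<le> w \<and> s \<le> w \<and> r + s > 0" if "(r, s) \<in> set ps" for r s
      proof -
        have "r + s \<in> set (map (\<lambda>(r, s). r + s) ps)" using that by force
        then have "r + s \<le> (\<Sum>(r, s)\<leftarrow>ps. r + s)" by (intro member_le_sum_list) simp_all
        then show ?thesis using w that by (auto simp: dynkin_indices_def)
      qed
      then have "set ps \<subseteq> ?P" using w by fastforce
      moreover have "length ps \<le> w" "length ps \<noteq> 0"
        using dynkin_indices_length w by (auto simp: dynkin_indices_def)
      ultimately show "ps \<in> (\<Union>m\<in>{1..c}. ?A m)" using w by (auto simp: Suc_le_eq)
    qed
    show "\<forall>ps\<in>(\<Union>m\<in>{1..c}. ?A m) - (\<Union>w\<in>{1..c}. dynkin_indices w). g ps = 0"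
    proof
      fix ps assume ps: "ps \<in> (\<Union>m\<in>{1..c}. ?A m) - (\<Union>w\<in>{1..c}. dynkin_indices w)"
      let ?w = "\<Sum>(r, s)\<leftarrow>ps. r + s"
      have dyn: "ps \<in> dynkin_indices ?w" using ps by (fastforce simp: dynkin_indices_def)
      then have "length ps \<le> ?w" by (rule dynkin_indices_length)
      moreover have "length ps \<ge> 1" using ps by auto
      ultimately have "?w \<ge> 1" by simp
      moreover have "?w \<notin> {1..c}" using ps dyn by blast
      ultimately have "?w > c" by simp
      moreover have "foldr bracket (bch_word x y ps) z \<in> F ?w"
        unfolding length_bch_word[of x y, symmetric] using x y z
        by (intro foldr_bracket_in_F subset_trans[OF set_bch_word]) auto
      ultimately show "g ps = 0" using F_vanish by (simp add: g_def)
    qed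
  qed
  also have "\<dots> = (\<Sum>w = 1..c. \<Sum>ps\<in>dynkin_indices w. g ps)"
    by (rule sum.UNION_disjoint) (auto simp: finite_dynkin_indices, auto simp: dynkin_indices_def)
  finally show ?thesis by (simp add: g_def)
qed

end

section \<open>Power series over a Lie algebra, extended by the Euler derivation\<close>

context lie_algebra
begin

text \<open>
  A pair \<open>(\<alpha>, f)\<close> stands for \<open>\<alpha> D + \<Sum>\<^sub>n f n t\<^sup>n\<close> in \<open>k D \<ltimes> L[[t]]\<close>, where
  \<open>D = t d/dt\<close> acts on \<open>L[[t]]\<close> as the function \<open>euler\<close> below.
\<close>

definition series_bracket :: "(nat \<Rightarrow> 'l) \<Rightarrow> (nat \<Rightarrow> 'l) \<Rightarrow> nat \<Rightarrow> 'l" where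
  "series_bracket f g n = (\<Sum>i\<le>n. \<lbrace>f i, g (n - i)\<rbrace>)"

definition euler :: "(nat \<Rightarrow> 'l) \<Rightarrow> nat \<Rightarrow> 'l" where
  "euler f n = of_nat n *s f n"

definition gr_scale :: "'k \<Rightarrow> 'k \<times> (nat \<Rightarrow> 'l) \<Rightarrow> 'k \<times> (nat \<Rightarrow> 'l)" where
  "gr_scale r a = (r * fst a, \<lambda>n. r *s snd a n)"

definition gr_bracket :: "'k \<times> (nat \<Rightarrow> 'l) \<Rightarrow> 'k \<times> (nat \<Rightarrow> 'l) \<Rightarrow> 'k \<times> (nat \<Rightarrow> 'l)" where
  "gr_bracket a b =
     (0, \<lambda>n. series_bracket (snd a) (snd b) n + fst a *s euler (snd b) n - fst b *s euler (snd a) n)"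

lemma series_bracket_antisym: "series_bracket f g n = - series_bracket g f n"
proof -
  have "series_bracket f g n = (\<Sum>i\<le>n. \<lbrace>f (n - i), g i\<rbrace>)"
    unfolding series_bracket_def
    by (rule sum.reindex_bij_witness[where i = "\<lambda>i. n - i" and j = "\<lambda>i. n - i"]) auto
  also have "\<dots> = (\<Sum>i\<le>n. - \<lbrace>g i, f (n - i)\<rbrace>)"
    by (intro sum.cong refl bracket_antisym)
  finally show ?thesis by (simp add: series_bracket_def sum_negf)
qed

text \<open>The terms for \<open>i\<close> and \<open>n - i\<close> cancel, and a middle term is 0
  by \<open>bracket_self\<close>. Deducing this from antisymmetry alone would require dividing by
  2.\<close>

lemma series_bracket_self: "series_bracket f f n = 0"
proof -
  let ?b = "\<lambda>i. \<lbrace>f i, f (n - i)\<rbrace>"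
  have "(\<Sum>i | i \<le> n \<and> n < 2 * i. ?b i) = (\<Sum>i | i \<le> n \<and> 2 * i < n. - ?b i)"
    by (rule sum.reindex_bij_witness[where i = "\<lambda>i. n - i" and j = "\<lambda>i. n - i"])
      (auto simp: bracket_antisym[of "f (n - _)"])
  moreover have "(\<Sum>i | i \<le> n \<and> 2 * i = n. ?b i) = 0"
    by (rule sum.neutral) (auto simp: bracket_self)
  moreover have "{..n} = {i. i \<le> n \<and> n < 2 * i} \<union> ({i. i \<le> n \<and> 2 * i < n} \<union> {i. i \<le> n \<and> 2 * i = n})"
    by auto
  then have "series_bracket f f n = (\<Sum>i | i \<le> n \<and> n < 2 * i. ?b i)
      + ((\<Sum>i | i \<le> n \<and> 2 * i < n. ?b i) + (\<Sum>i | i \<le> n \<and> 2 * i = n. ?b i))"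
    unfolding series_bracket_def by (simp only:) (subst sum.union_disjoint; auto)+
  ultimately show ?thesis by (simp add: sum_negf)
qed

text \<open>Indexing by triples is symmetric in the three series, so that the Jacobi identity can be
  applied term by term.\<close>

lemma series_bracket_nested:
  "series_bracket f (series_bracket g h) n
    = (\<Sum>(i, j, k)\<in>{(i, j, k). i + j + k = n}. \<lbrace>f i, \<lbrace>g j, h k\<rbrace>\<rbrace>)"
proof -
  have "series_bracket f (series_bracket g h) n
      = (\<Sum>(i, j)\<in>(SIGMA i:{..n}. {..n - i}). \<lbrace>f i, \<lbrace>g j, h (n - i - j)\<rbrace>\<rbrace>)"
    by (simp add: series_bracket_def bracket_sum_right sum.Sigma)
  also have "\<dots> = (\<Sum>(i, j, k)\<in>{(i, j, k). i + j + k = n}. \<lbrace>f i, \<lbrace>g j, h k\<rbrace>\<rbrace>)"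
    by (rule sum.reindex_bij_witness[where i = "\<lambda>(i, j, k). (i, j)" and j = "\<lambda>(i, j). (i, j, n - i - j)"])
      auto
  finally show ?thesis .
qed

lemma series_bracket_jacobi:
  "series_bracket f (series_bracket g h) n + series_bracket g (series_bracket h f) n
    + series_bracket h (series_bracket f g) n = 0"
proof -
  let ?T = "{(i, j, k). i + j + k = n}"
  have "series_bracket g (series_bracket h f) n = (\<Sum>(i, j, k)\<in>?T. \<lbrace>g j, \<lbrace>h k, f i\<rbrace>\<rbrace>)"
    unfolding series_bracket_nested
    by (rule sum.reindex_bij_witness[where i = "\<lambda>(i, j, k). (j, k, i)" and j = "\<lambda>(j, k, i). (i, j, k)"]) auto
  moreover have "series_bracket h (series_bracket f g) n = (\<Sum>(i, j, k)\<in>?T. \<lbrace>h k, \<lbrace>f i, g j\<rbrace>\<rbrace>)"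
    unfolding series_bracket_nested
    by (rule sum.reindex_bij_witness[where i = "\<lambda>(i, j, k). (k, i, j)" and j = "\<lambda>(k, i, j). (i, j, k)"]) auto
  ultimately have "series_bracket f (series_bracket g h) n + series_bracket g (series_bracket h f) n
      + series_bracket h (series_bracket f g) n
    = (\<Sum>(i, j, k)\<in>?T. \<lbrace>f i, \<lbrace>g j, h k\<rbrace>\<rbrace> + \<lbrace>g j, \<lbrace>h k, f i\<rbrace>\<rbrace> + \<lbrace>h k, \<lbrace>f i, g j\<rbrace>\<rbrace>)"
    unfolding series_bracket_nested by (simp add: sum.distrib case_prod_unfold)
  also have "\<dots> = 0" by (simp add: jacobi)
  finally show ?thesis .
qed

lemma euler_series_bracket:
  "euler (series_bracket f g) n = series_bracket (euler f) g n + series_bracket f (euler g) n"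
  unfolding euler_def series_bracket_def scale_sum_right sum.distrib[symmetric]
proof (rule sum.cong[OF refl])
  fix i assume "i \<in> {..n}"
  then have "of_nat n = (of_nat i + of_nat (n - i) :: 'k)" by (simp flip: of_nat_add)
  then show "of_nat n *s \<lbrace>f i, g (n - i)\<rbrace>
      = \<lbrace>of_nat i *s f i, g (n - i)\<rbrace> + \<lbrace>f i, of_nat (n - i) *s g (n - i)\<rbrace>"
    by (simp only: bracket_scale_left bracket_scale_right scale_left_distrib)
qed

lemma series_bracket_linear:
  "series_bracket (\<lambda>n. f n + f' n) g n = series_bracket f g n + series_bracket f' g n"
  "series_bracket f (\<lambda>n. g n + g' n) n = series_bracket f g n + series_bracket f g' n"
  "series_bracket f (\<lambda>n. g n - g' n) n = series_bracket f g n - series_bracket f g' n"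
  "series_bracket (\<lambda>n. r *s f n) g n = r *s series_bracket f g n"
  "series_bracket f (\<lambda>n. r *s g n) n = r *s series_bracket f g n"
  by (simp_all add: series_bracket_def bracket_add_left bracket_add_right bracket_diff_right
      bracket_scale_left bracket_scale_right sum.distrib sum_subtractf scale_sum_right)

lemma euler_linear:
  "euler (\<lambda>n. f n + g n) n = euler f n + euler g n"
  "euler (\<lambda>n. f n - g n) n = euler f n - euler g n"
  "euler (\<lambda>n. r *s f n) n = r *s euler f n"
  by (simp_all add: euler_def scale_right_distrib scale_right_diff_distrib mult.commute)

lemma gr_vector_space: "vector_space gr_scale"
  by unfold_locales (auto simp: gr_scale_def prod_eq_iff fun_eq_iff algebra_simps
      scale_right_distrib scale_left_distrib)

text \<open>A normal form for the cyclic sum: the triple brackets cancel by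
  \<open>series_bracket_jacobi\<close>, the terms with \<open>euler\<close> in pairs, using
  antisymmetry.\<close>

lemma gr_jacobi_term:
  "snd (gr_bracket (\<alpha>, f) (gr_bracket (\<beta>, g) (\<gamma>, h))) n
    = series_bracket f (series_bracket g h) n + \<beta> *s series_bracket f (euler h) n
      - \<gamma> *s series_bracket f (euler g) n
      + \<alpha> *s (series_bracket (euler g) h n + series_bracket g (euler h) n)
      + (\<alpha> * \<beta>) *s euler (euler h) n - (\<alpha> * \<gamma>) *s euler (euler g) n"
  by (simp add: gr_bracket_def series_bracket_linear euler_linear euler_series_bracket
      scale_right_distrib scale_right_diff_distrib algebra_simps)

lemma gr_lie_algebra: "lie_algebra gr_scale gr_bracket"
proof -
  interpret gr: vector_space gr_scale by (rule gr_vector_space)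
  show ?thesis
  proof
    fix a b d :: "'k \<times> (nat \<Rightarrow> 'l)"
    obtain \<alpha> f where a: "a = (\<alpha>, f)" by (cases a)
    obtain \<beta> g where b: "b = (\<beta>, g)" by (cases b)
    obtain \<gamma> h where d: "d = (\<gamma>, h)" by (cases d)
    show "gr_bracket a a = 0"
      by (simp add: a gr_bracket_def series_bracket_self prod_eq_iff fun_eq_iff)
    show "gr_bracket a (gr_bracket b d) + gr_bracket b (gr_bracket d a) + gr_bracket d (gr_bracket a b) = 0"
    proof (rule prod_eqI)
      show "snd (gr_bracket a (gr_bracket b d) + gr_bracket b (gr_bracket d a) + gr_bracket d (gr_bracket a b))
          = snd 0"
      proof
        fix n
        show "snd (gr_bracket a (gr_bracket b d) + gr_bracket b (gr_bracket d a) + gr_bracket d (gr_bracket a b)) n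
          = snd 0 n"
          using series_bracket_jacobi[of f g h n]
          unfolding a b d snd_add plus_fun_apply gr_jacobi_term
            series_bracket_antisym[of "euler _"]
          by (simp add: algebra_simps scale_right_distrib)
      qed
    qed (simp add: gr_bracket_def)
  qed (simp_all add: linear_iff gr.vector_space_axioms gr_bracket_def gr_scale_def prod_eq_iff
      fun_eq_iff plus_fun_def
      series_bracket_linear euler_linear algebra_simps scale_right_distrib scale_left_distrib
      scale_right_diff_distrib)
qed

end

section \<open>The graded extension\<close>

context filtered_lie_algebra
begin

text \<open>The level is the lowest degree in \<open>t\<close>, with \<open>D\<close> allowed only
  in level 0. Requiring the coefficient of degree \<open>m\<close> to lie in \<open>F m\<close>
  makes all degrees above \<open>c\<close> vanish, although the series are formally
  infinite.\<close>

definition gr_F :: "nat \<Rightarrow> ('k \<times> (nat \<Rightarrow> 'l)) set" where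
  "gr_F n = {a. (n > 0 \<longrightarrow> fst a = 0) \<and> (\<forall>m. snd a m \<in> F m) \<and> (\<forall>m<n. snd a m = 0)}"

lemma gr_filtered: "filtered_lie_algebra gr_scale gr_bracket gr_F c"
proof -
  interpret gr: lie_algebra gr_scale gr_bracket by (rule gr_lie_algebra)
  show ?thesis
  proof
    show "gr.subspace (gr_F n)" for n
      by (auto simp: gr.subspace_def gr_F_def gr_scale_def F_add F_scale)
    show "gr_F (Suc n) \<subseteq> gr_F n" for n
      by (auto simp: gr_F_def)
    show "gr_F (Suc c) = {0}"
    proof -
      have "a = 0" if "a \<in> gr_F (Suc c)" for a
      proof (rule prod_eqI)
        show "snd a = snd 0"
        proof
          fix m
          show "snd a m = snd 0 m"
            using that F_vanish[of "snd a m" m] by (cases "m \<le> c") (auto simp: gr_F_def)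
        qed
      qed (use that in \<open>simp add: gr_F_def\<close>)
      then show ?thesis by (auto simp: gr_F_def)
    qed
    show "(of_nat n :: 'k) \<noteq> 0" if "1 \<le> n" "n \<le> c" for n
      using that by (rule of_nat_nonzero)
    fix a b i j assume a: "a \<in> gr_F i" and b: "b \<in> gr_F j"
    have "series_bracket (snd a) (snd b) m \<in> F m" for m
      unfolding series_bracket_def
    proof (rule F_sum)
      fix k assume "k \<in> {..m}"
      then show "\<lbrace>snd a k, snd b (m - k)\<rbrace> \<in> F m"
        using F_bracket[of "snd a k" k "snd b (m - k)" "m - k"] a b by (simp add: gr_F_def)
    qed
    moreover have "series_bracket (snd a) (snd b) m = 0" if "m < i + j" for m
      unfolding series_bracket_def
    proof (rule sum.neutral, rule ballI)
      fix k assume "k \<in> {..m}"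
      then have "k < i \<or> m - k < j" using that by auto
      then show "\<lbrace>snd a k, snd b (m - k)\<rbrace> = 0"
        using a b by (auto simp: gr_F_def)
    qed
    moreover have "fst a *s euler (snd b) m = 0" if "m < i + j" for m
      using a b that by (cases "i = 0") (auto simp: gr_F_def euler_def)
    moreover have "fst b *s euler (snd a) m = 0" if "m < i + j" for m
      using a b that by (cases "j = 0") (auto simp: gr_F_def euler_def)
    moreover have "euler (snd a) m \<in> F m" "euler (snd b) m \<in> F m" for m
      using a b by (auto simp: gr_F_def euler_def F_scale)
    ultimately show "gr_bracket a b \<in> gr_F (i + j)"
      by (auto simp: gr_F_def gr_bracket_def F_add F_diff F_scale simp del: scale_eq_0_iff)
  qed
qed

interpretation gr: filtered_lie_algebra gr_scale gr_bracket gr_F c by (rule gr_filtered)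

definition euler_elem :: "'k \<times> (nat \<Rightarrow> 'l)" where
  "euler_elem = (1, 0)"

definition monomial :: "nat \<Rightarrow> 'l \<Rightarrow> 'k \<times> (nat \<Rightarrow> 'l)" where
  "monomial n z = (0, \<lambda>m. if m = n then z else 0)"

lemma euler_elem_in [simp]: "euler_elem \<in> gr_F 0"
  by (auto simp: euler_elem_def gr_F_def)

lemma monomial_in: "z \<in> F n \<Longrightarrow> m \<le> n \<Longrightarrow> monomial n z \<in> gr_F m"
  by (auto simp: monomial_def gr_F_def)

lemma gr_bracket_euler_elem_left: "snd (gr_bracket euler_elem a) n = of_nat n *s snd a n"
  by (simp add: gr_bracket_def euler_elem_def series_bracket_def euler_def)

lemma gr_bracket_euler_elem_right: "snd (gr_bracket a euler_elem) n = - (of_nat n *s snd a n)"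
  by (simp add: gr_bracket_def euler_elem_def series_bracket_def euler_def)

lemma gr_bracket_euler_elem_monomial:
  "gr_bracket euler_elem (monomial n z) = gr_scale (of_nat n) (monomial n z)"
  "gr_bracket (monomial n z) euler_elem = - gr_scale (of_nat n) (monomial n z)"
  by (auto simp: prod_eq_iff fun_eq_iff gr_bracket_euler_elem_left gr_bracket_euler_elem_right
      gr_scale_def monomial_def) (simp_all add: gr_bracket_def)

lemma gr_bracket_monomial: "gr_bracket (monomial i x) (monomial j y) = monomial (i + j) \<lbrace>x, y\<rbrace>"
proof -
  have "series_bracket (\<lambda>m. if m = i then x else 0) (\<lambda>m. if m = j then y else 0) n
      = (if n = i + j then \<lbrace>x, y\<rbrace> else 0)" for n
  proof -
    have "series_bracket (\<lambda>m. if m = i then x else 0) (\<lambda>m. if m = j then y else 0) n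
        = (\<Sum>k\<le>n. if k = i then \<lbrace>x, if n - i = j then y else 0\<rbrace> else 0)"
      unfolding series_bracket_def by (intro sum.cong) auto
    also have "\<dots> = (if n = i + j then \<lbrace>x, y\<rbrace> else 0)" by auto
    finally show ?thesis .
  qed
  then show ?thesis by (simp add: monomial_def gr_bracket_def prod_eq_iff fun_eq_iff)
qed

section \<open>Recovering an element from the action of its exponential on the Euler element\<close>

lemma gr_F_raise:
  assumes "a \<in> gr_F n" "snd a n = 0" "n \<ge> 1"
  shows "a \<in> gr_F (Suc n)"
  using assms by (auto simp: gr_F_def less_Suc_eq)

text \<open>Bracketing with \<open>D\<close> multiplies the lowest coefficient by
  \<open>- n\<close>. For \<open>n \<le> c\<close> this is invertible; for larger \<open>n\<close>
  the coefficient is 0 anyway.\<close>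

lemma bracket_euler_elem_raise:
  assumes a: "a \<in> gr_F n" and "n \<ge> 1" and D: "gr_bracket a euler_elem \<in> gr_F (Suc n)"
  shows "a \<in> gr_F (Suc n)"
proof (rule gr_F_raise[OF a _ \<open>n \<ge> 1\<close>])
  have "of_nat n *s snd a n = 0"
    using D gr_bracket_euler_elem_right[of a n] by (simp add: gr_F_def)
  moreover have "snd a n \<in> F n" using a by (simp add: gr_F_def)
  ultimately show "snd a n = 0"
    using of_nat_nonzero[of n] F_vanish[of "snd a n" n] \<open>n \<ge> 1\<close> by (cases "n \<le> c") auto
qed

text \<open>If \<open>b - a\<close> lies in level \<open>n\<close>, comparing the exponentials to
  first order puts \<open>[b - a, D]\<close> in level \<open>n + 1\<close>, and hence
  \<open>b - a\<close> itself. Iterating reaches the zero level.\<close>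

lemma exp_ad_euler_elem_inj:
  assumes a: "a \<in> gr_F 1" and b: "b \<in> gr_F 1"
    and eq: "gr.exp_ad a euler_elem = gr.exp_ad b euler_elem"
  shows "a = b"
proof -
  have "b - a \<in> gr_F (Suc n)" for n
  proof (induction n)
    case 0
    show ?case using gr.F_diff[OF b a] by simp
  next
    case (Suc n)
    have "- gr_bracket (b - a) euler_elem \<in> gr_F (Suc (Suc n))"
      using gr.exp_ad_perturb[OF a Suc _ euler_elem_in] eq by simp
    then have "gr_bracket (b - a) euler_elem \<in> gr_F (Suc (Suc n))"
      using gr.F_neg[of "- gr_bracket (b - a) euler_elem"] by simp
    then show ?case using bracket_euler_elem_raise[OF Suc] by simp
  qed
  from this[of c] have "b - a = 0" using gr.F_Suc_c by blast
  then show ?thesis by simp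
qed

text \<open>The solution is built one degree at a time, each correction removing the lowest term of
  the error.\<close>

lemma exp_ad_euler_elem_surj:
  assumes q: "q \<in> gr_F 1"
  shows "\<exists>b\<in>gr_F 1. gr.exp_ad b euler_elem = euler_elem + q"
proof -
  have "\<exists>b\<in>gr_F 1. gr.exp_ad b euler_elem - (euler_elem + q) \<in> gr_F (Suc n)" for n
  proof (induction n)
    case 0
    have "gr.exp_ad 0 euler_elem - (euler_elem + q) \<in> gr_F 1"
      using gr.F_diff[OF gr.exp_ad_minus_self_in_F[OF gr.F_zero euler_elem_in] , of q] q
      by (simp add: diff_diff_eq)
    then show ?case by auto
  next
    case (Suc n)
    then obtain b where b: "b \<in> gr_F 1" and
      e: "gr.exp_ad b euler_elem - (euler_elem + q) \<in> gr_F (Suc n)" (is "?e \<in> _") by blast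
    show ?case
    proof (cases "Suc n \<le> c")
      case False
      then have "?e = 0" using gr.F_vanish[OF e] by simp
      then show ?thesis using b by (metis gr.F_zero)
    next
      case True
      \<comment> \<open>As \<open>[d, D] = - (n + 1) d\<close>, this choice makes the first-order
        change cancel the error in degree \<open>n + 1\<close>.\<close>
      define d where "d = monomial (Suc n) (inverse (of_nat (Suc n)) *s snd ?e (Suc n))"
      have dn: "d \<in> gr_F (Suc n)"
        unfolding d_def using e by (intro monomial_in F_scale) (simp_all add: gr_F_def)
      have "snd (?e + gr_bracket d euler_elem) (Suc n) = 0"
        using of_nat_nonzero[of "Suc n"] True
        by (simp add: gr_bracket_euler_elem_right d_def monomial_def del: of_nat_Suc)
      moreover have "?e + gr_bracket d euler_elem \<in> gr_F (Suc n)"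
        using gr.F_add[OF e] gr.F_bracket[OF dn euler_elem_in] by simp
      ultimately have "?e + gr_bracket d euler_elem \<in> gr_F (Suc (Suc n))"
        using gr_F_raise by simp
      moreover have "gr.exp_ad (b + d) euler_elem - gr.exp_ad b euler_elem - gr_bracket d euler_elem
          \<in> gr_F (Suc (Suc n))"
        using gr.exp_ad_perturb[OF b dn _ euler_elem_in] by simp
      ultimately have "(gr.exp_ad (b + d) euler_elem - gr.exp_ad b euler_elem - gr_bracket d euler_elem)
          + (?e + gr_bracket d euler_elem) \<in> gr_F (Suc (Suc n))"
        using gr.F_add by blast
      then have "gr.exp_ad (b + d) euler_elem - (euler_elem + q) \<in> gr_F (Suc (Suc n))"
        by (simp add: algebra_simps)
      moreover have "b + d \<in> gr_F 1" using gr.F_add[OF b] gr.F_weaken[OF dn] by simp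
      ultimately show ?thesis by blast
    qed
  qed
  from this[of c] show ?thesis using gr.F_Suc_c by auto
qed

text \<open>Reduces identities between linear maps on \<open>gr_F 0\<close> to
  \<open>euler_elem\<close> and monomials. The sum can stop at \<open>c\<close> since the
  coefficient of degree \<open>n\<close> lies in \<open>F n\<close>.\<close>

lemma gr_F_decompose:
  assumes "a \<in> gr_F 0"
  shows "a = gr_scale (fst a) euler_elem + (\<Sum>n\<le>c. monomial n (snd a n))"
proof (rule prod_eqI)
  have fs: "fst (\<Sum>n\<in>I. monomial n (f n)) = 0" for I f
    by (simp add: fst_sum monomial_def)
  have ss: "snd (\<Sum>n\<in>I. monomial n (f n)) m = (\<Sum>n\<in>I. if m = n then f n else 0)" for I f m
    by (induction I rule: infinite_finite_induct) (auto simp: monomial_def)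
  show "fst a = fst (gr_scale (fst a) euler_elem + (\<Sum>n\<le>c. monomial n (snd a n)))"
    by (simp add: fs gr_scale_def euler_elem_def)
  show "snd a = snd (gr_scale (fst a) euler_elem + (\<Sum>n\<le>c. monomial n (snd a n)))"
  proof
    fix m
    have "snd a m = 0" if "m > c" using assms F_vanish[of "snd a m" m] that by (simp add: gr_F_def)
    then show "snd a m = snd (gr_scale (fst a) euler_elem + (\<Sum>n\<le>c. monomial n (snd a n))) m"
      by (auto simp: ss gr_scale_def euler_elem_def)
  qed
qed

text \<open>
  Both sides are Lie algebra homomorphisms that are the identity modulo terms of higher degree. If
  they agree on \<open>D\<close>, their difference on \<open>z t\<^sup>n\<close> is an eigenvector of \<open>D\<close> (up to higher degree)
  for the eigenvalue \<open>n\<close>, concentrated in degrees above \<open>n\<close>; the eigenvalues \<open>0, \<dots>, c\<close> are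
  distinct in \<open>k\<close>.
\<close>

lemma exp_ad_determined:
  assumes a: "a \<in> gr_F 1" and x: "x \<in> gr_F 1" and y: "y \<in> gr_F 1"
    and eq: "gr.exp_ad a euler_elem = gr.exp_ad x (gr.exp_ad y euler_elem)"
    and w: "w \<in> gr_F 0"
  shows "gr.exp_ad a w = gr.exp_ad x (gr.exp_ad y w)"
proof -
  have mono: "gr.exp_ad a (monomial n z) = gr.exp_ad x (gr.exp_ad y (monomial n z))"
    if z: "z \<in> F n" for n z
  proof -
    define u where "u = monomial n z"
    define d where "d = gr.exp_ad a u - gr.exp_ad x (gr.exp_ad y u)"
    define q where "q = gr.exp_ad a euler_elem - euler_elem"
    have un: "u \<in> gr_F n" and u0: "u \<in> gr_F 0"
      using z by (auto simp: u_def intro: monomial_in)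
    have q: "q \<in> gr_F 1"
      unfolding q_def using gr.exp_ad_minus_self_in_F[OF a euler_elem_in] by simp
    have Du: "gr_bracket euler_elem u = gr_scale (of_nat n) u"
      by (simp add: u_def gr_bracket_euler_elem_monomial)
    have "gr_bracket (gr.exp_ad a euler_elem) d
        = gr.exp_ad a (gr_bracket euler_elem u) - gr.exp_ad x (gr.exp_ad y (gr_bracket euler_elem u))"
      unfolding d_def gr.bracket_diff_right
      using gr.exp_ad_bracket[OF a euler_elem_in u0] gr.exp_ad_bracket[OF y euler_elem_in u0]
        gr.exp_ad_bracket[OF x gr.exp_ad_in_F[OF y euler_elem_in] gr.exp_ad_in_F[OF y u0]]
      by (simp add: eq)
    also have "\<dots> = gr_scale (of_nat n) d"
      by (simp add: Du gr.exp_ad_scale d_def gr.scale_right_diff_distrib)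
    finally have d_eq: "gr_bracket euler_elem d + gr_bracket q d = gr_scale (of_nat n) d"
      by (simp add: q_def gr.bracket_diff_left)
    have "d \<in> gr_F (Suc n + k)" for k
    proof (induction k)
      case 0
      have "gr.exp_ad a u - u \<in> gr_F (Suc n)" "gr.exp_ad y u - u \<in> gr_F (Suc n)"
        "gr.exp_ad x (gr.exp_ad y u) - gr.exp_ad y u \<in> gr_F (Suc n)"
        using a x y un by (simp_all add: gr.exp_ad_minus_self_in_F gr.exp_ad_in_F)
      then have "(gr.exp_ad a u - u) - (gr.exp_ad x (gr.exp_ad y u) - gr.exp_ad y u) - (gr.exp_ad y u - u)
          \<in> gr_F (Suc n)"
        using gr.F_diff by blast
      then show ?case by (simp add: d_def)
    next
      case (Suc k)
      have "snd (gr_bracket q d) (Suc n + k) = 0"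
        using gr.F_bracket_left[OF q Suc] by (simp add: gr_F_def)
      then have "of_nat (Suc n + k) *s snd d (Suc n + k) = of_nat n *s snd d (Suc n + k)"
        using arg_cong[OF d_eq, of "\<lambda>v. snd v (Suc n + k)"]
        by (simp add: gr_bracket_euler_elem_left gr_scale_def del: of_nat_Suc of_nat_add)
      then have "of_nat (Suc k) *s snd d (Suc n + k) = 0"
        by (simp add: scale_left_distrib algebra_simps)
      moreover have "snd d (Suc n + k) \<in> F (Suc n + k)" using Suc by (simp add: gr_F_def)
      \<comment> \<open>The difference \<open>Suc k\<close> of the eigenvalues is invertible if it
        is at most \<open>c\<close>; otherwise the degree exceeds \<open>c\<close> and the
        coefficient vanishes.\<close>
      ultimately have "snd d (Suc n + k) = 0"
        using of_nat_nonzero[of "Suc k"] F_vanish[of "snd d (Suc n + k)" "Suc n + k"]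
        by (cases "Suc k \<le> c") (auto simp del: of_nat_Suc)
      then show ?case using gr_F_raise[OF Suc] by simp
    qed
    then have "d = 0" using gr.F_vanish[of d "Suc n + c"] by simp
    then show ?thesis by (simp add: d_def u_def)
  qed
  have "snd w n \<in> F n" for n using w by (simp add: gr_F_def)
  then show ?thesis
    by (subst (1 2) gr_F_decompose[OF w])
      (simp add: gr.exp_ad_add gr.exp_ad_sum gr.exp_ad_scale eq mono)
qed

text \<open>
  The reason for Dynkin's nested brackets: since \<open>[x t, D] = - x t\<close>, they are what a word in the
  operators \<open>ad (x t)\<close>, \<open>ad (y t)\<close> does to \<open>D\<close>.
\<close>

lemma foldr_gr_bracket_euler_elem:
  "ws \<noteq> [] \<Longrightarrow> foldr gr_bracket (map (monomial 1) ws) euler_elem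
    = - monomial (length ws) (nested_bracket ws)"
  by (induction ws rule: nested_bracket.induct)
    (simp_all add: gr_bracket_euler_elem_monomial gr.bracket_minus_right gr_bracket_monomial)

text \<open>Dynkin's extra factor \<open>n\<close> in the denominator is the eigenvalue of
  \<open>D\<close> in degree \<open>n\<close>; clearing it leaves the coefficients of the plain
  logarithm.\<close>

lemma of_nat_scale_bch_component:
  assumes "1 \<le> n" "n \<le> c"
  shows "of_nat n *s bch_component n x y
    = (\<Sum>ps\<in>dynkin_indices n.
        ((- 1) ^ (length ps - 1) / of_nat (length ps * (\<Prod>(r, s)\<leftarrow>ps. fact r * fact s)))
          *s nested_bracket (bch_word x y ps))"
proof -
  have "of_nat n * (a / of_nat (l * n * k)) = (a / of_nat (l * k) :: 'k)" for a and l k :: nat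
    using of_nat_nonzero[OF assms] by simp
  then show ?thesis by (simp only: bch_component_def scale_sum_right scale_scale)
qed

text \<open>Surjectivity gives \<open>b\<close> with the right value at \<open>D\<close>, and
  \<open>exp_ad_determined\<close> extends the agreement to \<open>gr_F 0\<close>. Taking logarithms
  at \<open>D\<close> then compares \<open>- n\<close> times the coefficient of \<open>b\<close>
  with \<open>- n\<close> times Dynkin's component.\<close>

lemma gr_exp_ad_bch:
  assumes x: "x \<in> F 1" and y: "y \<in> F 1"
  obtains b where "b \<in> gr_F 1" "\<And>n. n \<in> {1..c} \<Longrightarrow> snd b n = bch_component n x y"
    "\<And>w. w \<in> gr_F 0 \<Longrightarrow> gr.exp_ad b w = gr.exp_ad (monomial 1 x) (gr.exp_ad (monomial 1 y) w)"
proof -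
  let ?X = "monomial 1 x" and ?Y = "monomial 1 y"
  have X: "?X \<in> gr_F 1" and Y: "?Y \<in> gr_F 1" using x y by (auto intro: monomial_in)
  define q where "q = gr.exp_ad ?X (gr.exp_ad ?Y euler_elem) - euler_elem"
  have "(gr.exp_ad ?X (gr.exp_ad ?Y euler_elem) - gr.exp_ad ?Y euler_elem)
      + (gr.exp_ad ?Y euler_elem - euler_elem) \<in> gr_F 1"
    using gr.F_add[OF gr.exp_ad_minus_self_in_F[OF X gr.exp_ad_in_F[OF Y euler_elem_in]]
        gr.exp_ad_minus_self_in_F[OF Y euler_elem_in]] by simp
  then have "q \<in> gr_F 1" by (simp add: q_def)
  then obtain b where b: "b \<in> gr_F 1"
    and bD: "gr.exp_ad b euler_elem = gr.exp_ad ?X (gr.exp_ad ?Y euler_elem)"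
    using exp_ad_euler_elem_surj[of q] by (auto simp: q_def)
  have eq: "gr.exp_ad b w = gr.exp_ad ?X (gr.exp_ad ?Y w)" if "w \<in> gr_F 0" for w
    using exp_ad_determined[OF b X Y bD that] .
  \<comment> \<open>Membership in \<open>gr_F 0\<close> is carried along because the two operators
    are known to agree only there.\<close>
  have pow: "((\<lambda>w. gr.exp_ad b w - w) ^^ m) euler_elem \<in> gr_F 0
      \<and> ((\<lambda>w. gr.exp_ad b w - w) ^^ m) euler_elem
        = ((\<lambda>w. gr.exp_ad ?X (gr.exp_ad ?Y w) - w) ^^ m) euler_elem" for m
    by (induction m) (auto intro!: gr.F_diff gr.exp_ad_in_F[OF b] simp: eq)
  have "gr_bracket b euler_elem
    = (\<Sum>m = 1..c. gr_scale ((- 1) ^ (m - 1) / of_nat m) (((\<lambda>w. gr.exp_ad b w - w) ^^ m) euler_elem))"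
    by (rule gr.log_exp_ad[OF b euler_elem_in, symmetric])
  also have "\<dots> = (\<Sum>m = 1..c. gr_scale ((- 1) ^ (m - 1) / of_nat m)
      (((\<lambda>w. gr.exp_ad ?X (gr.exp_ad ?Y w) - w) ^^ m) euler_elem))"
    using pow by simp
  also have "\<dots> = (\<Sum>w = 1..c. \<Sum>ps\<in>dynkin_indices w.
        gr_scale ((- 1) ^ (length ps - 1) / of_nat (length ps * (\<Prod>(r, s)\<leftarrow>ps. fact r * fact s)))
          (foldr gr_bracket (bch_word ?X ?Y ps) euler_elem))"
    by (rule gr.log_exp_ad_exp_ad[OF X Y euler_elem_in])
  also have "\<dots> = (\<Sum>w = 1..c. - monomial w (of_nat w *s bch_component w x y))"
  proof (rule sum.cong[OF refl])
    fix w assume w: "w \<in> {1..c}"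
    have "foldr gr_bracket (bch_word ?X ?Y ps) euler_elem = - monomial w (nested_bracket (bch_word x y ps))"
      if "ps \<in> dynkin_indices w" for ps
    proof -
      have len: "length (bch_word x y ps) = w" using that by (rule length_bch_word_dynkin)
      then have "bch_word x y ps \<noteq> []" using w by fastforce
      from foldr_gr_bracket_euler_elem[OF this] show ?thesis
        unfolding map_bch_word len by simp
    qed
    moreover have "gr_scale r (- monomial w v) = - monomial w (r *s v)" for r v
      by (auto simp: gr_scale_def monomial_def prod_eq_iff)
    moreover have "(\<Sum>i\<in>I. - monomial w (f i)) = - monomial w (\<Sum>i\<in>I. f i)" for I :: "(nat \<times> nat) list set" and f
      by (induction I rule: infinite_finite_induct) (auto simp: monomial_def prod_eq_iff fun_eq_iff)
    ultimately show "(\<Sum>ps\<in>dynkin_indices w.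
        gr_scale ((- 1) ^ (length ps - 1) / of_nat (length ps * (\<Prod>(r, s)\<leftarrow>ps. fact r * fact s)))
          (foldr gr_bracket (bch_word ?X ?Y ps) euler_elem))
      = - monomial w (of_nat w *s bch_component w x y)"
      using w by (simp add: of_nat_scale_bch_component)
  qed
  finally have log: "gr_bracket b euler_elem = (\<Sum>w = 1..c. - monomial w (of_nat w *s bch_component w x y))" .
  have ss: "snd (\<Sum>w\<in>I. - monomial w (f w)) n = (\<Sum>w\<in>I. if n = w then - f w else 0)" for I f n
    by (induction I rule: infinite_finite_induct) (auto simp: monomial_def)
  have "snd b n = bch_component n x y" if "n \<in> {1..c}" for n
  proof -
    have "of_nat n *s snd b n = of_nat n *s bch_component n x y"
      using arg_cong[OF log, of "\<lambda>v. snd v n"] that by (simp add: gr_bracket_euler_elem_right ss)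
    then show ?thesis using of_nat_nonzero[of n] that by simp
  qed
  then show ?thesis using that b eq by blast
qed

text \<open>
  Evaluation at \<open>t = 1\<close>. It respects brackets only on series with \<open>n\<close>-th coefficient in \<open>F n\<close>.
\<close>

definition at_one :: "'k \<times> (nat \<Rightarrow> 'l) \<Rightarrow> 'l" where
  "at_one a = (\<Sum>n\<le>c. snd a n)"

lemma at_one_add: "at_one (a + b) = at_one a + at_one b"
  by (simp add: at_one_def sum.distrib)

lemma at_one_zero [simp]: "at_one 0 = 0"
  by (simp add: at_one_def)

lemma at_one_scale: "at_one (gr_scale r a) = r *s at_one a"
  by (simp add: at_one_def gr_scale_def scale_sum_right)

lemma at_one_sum: "at_one (\<Sum>i\<in>I. f i) = (\<Sum>i\<in>I. at_one (f i))"
  by (induction I rule: infinite_finite_induct) (simp_all add: at_one_add)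

lemma at_one_monomial: "z \<in> F n \<Longrightarrow> at_one (monomial n z) = z"
  using F_vanish[of z n] by (auto simp: at_one_def monomial_def)

lemma at_one_bracket:
  assumes a: "a \<in> gr_F 0" "fst a = 0" and b: "b \<in> gr_F 0" "fst b = 0"
  shows "at_one (gr_bracket a b) = \<lbrace>at_one a, at_one b\<rbrace>"
proof -
  let ?t = "\<lambda>i j. \<lbrace>snd a i, snd b j\<rbrace>"
  have zero: "?t i j = 0" if "i + j > c" for i j
    using F_vanish[OF F_bracket, of "snd a i" i "snd b j" j] a b that by (simp add: gr_F_def)
  have "\<lbrace>at_one a, at_one b\<rbrace> = (\<Sum>i\<le>c. \<Sum>j\<le>c. ?t i j)"
    unfolding at_one_def bracket_sum_left by (simp add: bracket_sum_right)
  also have "\<dots> = (\<Sum>(i, j)\<in>{..c} \<times> {..c}. ?t i j)"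
    by (simp add: sum.cartesian_product)
  also have "\<dots> = (\<Sum>(i, j)\<in>{(i, j). i + j \<le> c}. ?t i j)"
    by (rule sum.mono_neutral_right) (use zero in \<open>auto intro: leI\<close>)
  also have "\<dots> = (\<Sum>n\<le>c. \<Sum>i\<le>n. ?t i (n - i))"
    using sum.triangle_reindex_eq[of ?t c] by simp
  finally show ?thesis using a b by (simp add: at_one_def gr_bracket_def series_bracket_def)
qed

text \<open>The bracket series is evaluated term by term. A component of \<open>w\<close> along
  \<open>D\<close> is excluded because \<open>at_one\<close> discards it; brackets with
  \<open>a\<close> never create one.\<close>

lemma at_one_exp_ad:
  assumes a: "a \<in> gr_F 1" and w: "w \<in> gr_F 0" "fst w = 0"
  shows "at_one (gr.exp_ad a w) = exp_ad (at_one a) (at_one w)"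
proof -
  have a0: "a \<in> gr_F 0" "fst a = 0" using a gr.F_weaken[OF a] by (auto simp: gr_F_def)
  have "(gr_bracket a ^^ k) w \<in> gr_F 0 \<and> fst ((gr_bracket a ^^ k) w) = 0
      \<and> at_one ((gr_bracket a ^^ k) w) = (bracket (at_one a) ^^ k) (at_one w)" for k
  proof (induction k)
    case (Suc k)
    then show ?case
      using a0 gr.F_bracket[OF a0(1), of "(gr_bracket a ^^ k) w" 0] by (auto simp: at_one_bracket) (simp add: gr_bracket_def)
  qed (use w in auto)
  then show ?thesis by (simp add: gr.exp_ad_def exp_ad_def at_one_sum at_one_scale)
qed

text \<open>The identity for \<open>x t\<close> and \<open>y t\<close>, evaluated at
  \<open>t = 1\<close>.\<close>

theorem exp_ad_bch:
  assumes x: "x \<in> F 1" and y: "y \<in> F 1" and z: "z \<in> F 0"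
  shows "exp_ad (bch c x y) z = exp_ad x (exp_ad y z)"
proof -
  from gr_exp_ad_bch[OF x y] obtain b where b: "b \<in> gr_F 1"
    and bn: "\<And>n. n \<in> {1..c} \<Longrightarrow> snd b n = bch_component n x y"
    and eq: "\<And>w. w \<in> gr_F 0 \<Longrightarrow> gr.exp_ad b w = gr.exp_ad (monomial 1 x) (gr.exp_ad (monomial 1 y) w)"
    by blast
  have "at_one b = (\<Sum>n\<in>{1..c}. snd b n)"
    unfolding at_one_def by (rule sum.mono_neutral_right) (use b in \<open>auto simp: gr_F_def Suc_le_eq\<close>)
  also have "\<dots> = bch c x y" using bn by (simp add: bch_def)
  finally have eb: "at_one b = bch c x y" .
  \<comment> \<open>\<open>z\<close> is put in degree 0, being known only to lie in
    \<open>F 0\<close>.\<close>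
  have X: "monomial 1 x \<in> gr_F 1" and Y: "monomial 1 y \<in> gr_F 1" and Z: "monomial 0 z \<in> gr_F 0"
    using x y z by (auto intro: monomial_in)
  have fZ: "fst (monomial 0 z) = 0" by (simp add: monomial_def)
  have YZ: "gr.exp_ad (monomial 1 y) (monomial 0 z) \<in> gr_F 0" using gr.exp_ad_in_F[OF Y Z] .
  have "fst (gr.exp_ad (monomial 1 y) (monomial 0 z) - monomial 0 z) = 0"
    using gr.exp_ad_minus_self_in_F[OF Y Z] by (simp add: gr_F_def)
  then have fYZ: "fst (gr.exp_ad (monomial 1 y) (monomial 0 z)) = 0" using fZ by simp
  show ?thesis
    using arg_cong[OF eq[OF Z], of at_one]
    by (simp add: at_one_exp_ad b X Y Z YZ fZ fYZ eb at_one_monomial x y z del: One_nat_def)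
qed

lemma nested_bracket_in_F:
  "set ws \<subseteq> F 1 \<Longrightarrow> ws \<noteq> [] \<Longrightarrow> nested_bracket ws \<in> F (length ws)"
  by (induction ws rule: nested_bracket.induct) (auto intro: F_bracket_left[unfolded One_nat_def])

lemma bch_component_in_F:
  assumes "x \<in> F 1" "y \<in> F 1" "w \<ge> 1"
  shows "bch_component w x y \<in> F w"
  unfolding bch_component_def
proof (intro F_sum F_scale)
  fix ps assume "ps \<in> dynkin_indices w"
  then have len: "length (bch_word x y ps) = w" by (rule length_bch_word_dynkin)
  moreover have "bch_word x y ps \<noteq> []" using len \<open>w \<ge> 1\<close> by fastforce
  ultimately show "nested_bracket (bch_word x y ps) \<in> F w"
    using nested_bracket_in_F[OF subset_trans[OF set_bch_word]] assms by force
qed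

lemma bch_in_F: "x \<in> F 1 \<Longrightarrow> y \<in> F 1 \<Longrightarrow> bch c x y \<in> F 1"
  unfolding bch_def by (intro F_sum F_weaken[OF bch_component_in_F]) auto

end

section \<open>Associativity, by applying the theory to the graded extension itself\<close>

context filtered_lie_algebra
begin

interpretation gr: filtered_lie_algebra gr_scale gr_bracket gr_F c by (rule gr_filtered)

lemma at_one_nested_bracket:
  assumes "set ws \<subseteq> gr_F 1"
  shows "gr.nested_bracket ws \<in> gr_F 1 \<and> at_one (gr.nested_bracket ws) = nested_bracket (map at_one ws)"
  using assms
proof (induction ws rule: gr.nested_bracket.induct)
  case (3 x y zs)
  then have IH: "gr.nested_bracket (y # zs) \<in> gr_F 1"
      "at_one (gr.nested_bracket (y # zs)) = nested_bracket (map at_one (y # zs))" and x: "x \<in> gr_F 1" by auto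
  have "gr_bracket x (gr.nested_bracket (y # zs)) \<in> gr_F 2"
    using gr.F_bracket_left[OF x IH(1)] by (simp add: numeral_2_eq_2)
  then have "gr_bracket x (gr.nested_bracket (y # zs)) \<in> gr_F 1"
    by (rule gr.F_weaken) simp
  moreover have "u \<in> gr_F 0 \<and> fst u = 0" if "u \<in> gr_F 1" for u
    using that gr.F_weaken[OF that, of 0] by (auto simp: gr_F_def)
  ultimately show ?case using IH x by (simp add: at_one_bracket)
qed auto

lemma at_one_bch:
  assumes "a \<in> gr_F 1" "b \<in> gr_F 1"
  shows "at_one (gr.bch c a b) = bch c (at_one a) (at_one b)"
proof -
  have "at_one (gr.nested_bracket (bch_word a b ps)) = nested_bracket (bch_word (at_one a) (at_one b) ps)" for ps
    using at_one_nested_bracket[OF subset_trans[OF set_bch_word], of a b ps] assms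
    unfolding map_bch_word by auto
  then show ?thesis
    by (simp add: gr.bch_def bch_def gr.bch_component_def bch_component_def at_one_sum at_one_scale)
qed

text \<open>Both products have the same exponential, but inside \<open>L\<close> this determines
  them only up to elements with the same adjoint action. In the extension the value at
  \<open>D\<close> determines an element of level 1, and \<open>at_one\<close> carries the equality
  back.\<close>

theorem bch_assoc:
  assumes x: "x \<in> F 1" and y: "y \<in> F 1" and z: "z \<in> F 1"
  shows "bch c (bch c x y) z = bch c x (bch c y z)"
proof -
  let ?X = "monomial 1 x" and ?Y = "monomial 1 y" and ?Z = "monomial 1 z"
  have X: "?X \<in> gr_F 1" and Y: "?Y \<in> gr_F 1" and Z: "?Z \<in> gr_F 1"
    using x y z by (auto intro: monomial_in)
  note [simp] = X Y Z gr.bch_in_F gr.exp_ad_in_F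
  have "gr.bch c (gr.bch c ?X ?Y) ?Z = gr.bch c ?X (gr.bch c ?Y ?Z)"
    by (rule exp_ad_euler_elem_inj) (simp_all add: gr.exp_ad_bch del: One_nat_def)
  then have "at_one (gr.bch c (gr.bch c ?X ?Y) ?Z) = at_one (gr.bch c ?X (gr.bch c ?Y ?Z))" by simp
  then show ?thesis
    by (simp add: at_one_bch at_one_monomial x y z del: One_nat_def)
qed

end

section \<open>Terms of low weight\<close>

lemma dynkin_indices_0: "dynkin_indices 0 = {[]}"
proof -
  have "ps = []" if "ps \<in> dynkin_indices 0" for ps
    using dynkin_indices_length[OF that] by simp
  then show ?thesis by (auto simp: dynkin_indices_def)
qed

lemma dynkin_indices_Cons_iff:
  "(r, s) # ps \<in> dynkin_indices w \<longleftrightarrow> 0 < r + s \<and> r + s \<le> w \<and> ps \<in> dynkin_indices (w - (r + s))"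
  by (auto simp: dynkin_indices_def)

lemma Nil_in_dynkin_indices_iff: "[] \<in> dynkin_indices w \<longleftrightarrow> w = 0"
  by (auto simp: dynkin_indices_def)

lemma dynkin_indices_1: "dynkin_indices 1 = {[(1, 0)], [(0, 1)]}" (is "_ = ?R")
proof -
  have "ps \<in> ?R" if ps: "ps \<in> dynkin_indices 1" for ps
  proof (cases ps)
    case Nil
    then show ?thesis using ps by (simp add: Nil_in_dynkin_indices_iff)
  next
    case (Cons q qs)
    obtain r s where q: "q = (r, s)" by (cases q)
    have "0 < r + s" "r + s \<le> 1" and qs: "qs \<in> dynkin_indices (1 - (r + s))"
      using ps unfolding Cons q dynkin_indices_Cons_iff by auto
    then have "r = 1 \<and> s = 0 \<or> r = 0 \<and> s = 1" by arith
    then show ?thesis using qs by (auto simp: Cons q dynkin_indices_0)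
  qed
  then show ?thesis by (auto simp: dynkin_indices_def)
qed

lemma dynkin_indices_2:
  "dynkin_indices 2 = {[(2, 0)], [(1, 1)], [(0, 2)],
     [(1, 0), (1, 0)], [(1, 0), (0, 1)], [(0, 1), (1, 0)], [(0, 1), (0, 1)]}" (is "_ = ?R")
proof -
  have "ps \<in> ?R" if ps: "ps \<in> dynkin_indices 2" for ps
  proof (cases ps)
    case Nil
    then show ?thesis using ps by (simp add: Nil_in_dynkin_indices_iff)
  next
    case (Cons q qs)
    obtain r s where q: "q = (r, s)" by (cases q)
    have "0 < r + s" "r + s \<le> 2" and qs: "qs \<in> dynkin_indices (2 - (r + s))"
      using ps unfolding Cons q dynkin_indices_Cons_iff by auto
    then consider "r + s = 1" "r = 1 \<and> s = 0 \<or> r = 0 \<and> s = 1"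
      | "r + s = 2" "r = 2 \<and> s = 0 \<or> r = 1 \<and> s = 1 \<or> r = 0 \<and> s = 2" by arith
    then show ?thesis
    proof cases
      case 1
      then have "qs \<in> dynkin_indices 1" using qs by simp
      then show ?thesis using 1 unfolding dynkin_indices_1 by (auto simp: Cons q)
    next
      case 2
      then have "qs \<in> dynkin_indices 0" using qs by simp
      then show ?thesis using 2 unfolding dynkin_indices_0 by (auto simp: Cons q)
    qed
  qed
  then show ?thesis by (auto simp: dynkin_indices_def)
qed

context lie_algebra
begin

lemma bch_component_1: "bch_component 1 x y = x + y"
  by (simp add: bch_component_def dynkin_indices_1[simplified])

text \<open>The block \<open>(1, 1)\<close> contributes one half of the bracket; the two mixed lists
  of two blocks contribute minus a quarter of \<open>[x, y]\<close> and of \<open>[y, x]\<close>,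
  which cancel. The other words are 0.\<close>

lemma bch_component_2:
  assumes "(2 :: 'k) \<noteq> 0"
  shows "bch_component 2 x y = inverse 2 *s \<lbrace>x, y\<rbrace>"
proof -
  have "bch_component 2 x y = (1 / 2) *s \<lbrace>x, y\<rbrace> + (- (1 / 4) *s \<lbrace>x, y\<rbrace> + - (1 / 4) *s \<lbrace>y, x\<rbrace>)"
    unfolding bch_component_def dynkin_indices_2
    by (simp add: numeral_2_eq_2 bracket_self)
  also have "\<dots> = inverse 2 *s \<lbrace>x, y\<rbrace>"
    by (subst (3) bracket_antisym) (simp add: inverse_eq_divide)
  finally show ?thesis .
qed

end

section \<open>Approximating products and commutators modulo the filtration\<close>

context filtered_lie_algebra
begin

text \<open>The innermost bracket lies in \<open>F m\<close>, and each of the remaining letters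
  raises the level by one.\<close>

lemma nested_bracket_in_F_commuting:
  assumes "set ws \<subseteq> F 1" "length ws \<ge> 2" "\<And>u v. u \<in> set ws \<Longrightarrow> v \<in> set ws \<Longrightarrow> \<lbrace>u, v\<rbrace> \<in> F m"
  shows "nested_bracket ws \<in> F (m + (length ws - 2))"
  using assms
proof (induction ws rule: nested_bracket.induct)
  case (3 x y zs)
  show ?case
  proof (cases zs)
    case Nil
    then show ?thesis using 3 by simp
  next
    case (Cons u us)
    have "nested_bracket (y # zs) \<in> F (m + (length (y # zs) - 2))"
      using 3 Cons by simp
    then show ?thesis using F_bracket_left[of x] 3 Cons by fastforce
  qed
qed auto

lemma bch_component_in_F_commuting:
  assumes x: "x \<in> F 1" and y: "y \<in> F 1" and xy: "\<lbrace>x, y\<rbrace> \<in> F m" and "w \<ge> 2"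
  shows "bch_component w x y \<in> F (m + (w - 2))"
proof -
  have yx: "\<lbrace>y, x\<rbrace> \<in> F m" using F_neg[OF xy] by (simp flip: bracket_antisym[of y x])
  have uv: "\<lbrace>u, v\<rbrace> \<in> F m" if "u \<in> {x, y}" "v \<in> {x, y}" for u v
    using that xy yx by (auto simp: bracket_self)
  have "nested_bracket ws \<in> F (m + (w - 2))" if ws: "set ws \<subseteq> {x, y}" "length ws = w" for ws
  proof -
    have "set ws \<subseteq> F 1" using ws x y by blast
    moreover have "\<lbrace>u, v\<rbrace> \<in> F m" if "u \<in> set ws" "v \<in> set ws" for u v
      using that by (intro uv subsetD[OF ws(1)])
    ultimately show ?thesis using nested_bracket_in_F_commuting[of ws m] ws \<open>w \<ge> 2\<close> by simp
  qed
  then show ?thesis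
    unfolding bch_component_def
    by (intro F_sum F_scale) (simp only: set_bch_word length_bch_word_dynkin)
qed

lemma bch_approx_add:
  assumes x: "x \<in> F 1" and y: "y \<in> F 1" and xy: "\<lbrace>x, y\<rbrace> \<in> F m"
  shows "bch c x y - (x + y) \<in> F m"
proof (cases "c = 0")
  case True
  then have "x = 0" "y = 0" using F_vanish x y by auto
  then show ?thesis unfolding bch_def using True by simp
next
  case False
  then have "bch c x y = x + y + (\<Sum>w = 2..c. bch_component w x y)"
    using bch_component_1[of x y]
    by (simp add: bch_def sum.atLeast_Suc_atMost numeral_2_eq_2)
  moreover have "(\<Sum>w = 2..c. bch_component w x y) \<in> F m"
    by (intro F_sum F_weaken[OF bch_component_in_F_commuting[OF x y xy]]) auto
  ultimately show ?thesis by simp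
qed

text \<open>The case \<open>m = Suc c\<close>, where the congruence becomes an equality.\<close>

lemma bch_commuting: "x \<in> F 1 \<Longrightarrow> y \<in> F 1 \<Longrightarrow> \<lbrace>x, y\<rbrace> = 0 \<Longrightarrow> bch c x y = x + y"
  using bch_approx_add[of x y "Suc c"] F_Suc_c by auto

lemma bch_approx_bracket:
  assumes x: "x \<in> F 1" and y: "y \<in> F 1" and xy: "\<lbrace>x, y\<rbrace> \<in> F m" and c: "c \<ge> 2"
  shows "bch c x y - (x + y + inverse 2 *s \<lbrace>x, y\<rbrace>) \<in> F (Suc m)"
proof -
  have "(2 :: 'k) \<noteq> 0" using of_nat_nonzero[of 2] c by simp
  then have "bch c x y = x + y + (inverse 2 *s \<lbrace>x, y\<rbrace> + (\<Sum>w = 3..c. bch_component w x y))"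
    using bch_component_1[of x y] bch_component_2[of x y] c
    by (simp add: bch_def sum.atLeast_Suc_atMost numeral_2_eq_2 numeral_3_eq_3)
  moreover have "(\<Sum>w = 3..c. bch_component w x y) \<in> F (Suc m)"
    by (intro F_sum F_weaken[OF bch_component_in_F_commuting[OF x y xy]]) auto
  ultimately show ?thesis by (simp add: algebra_simps)
qed

text \<open>Negation being the group inverse, this is the group commutator
  \<open>(x y) (y x)\<^sup>-\<^sup>1\<close>. The two products differ by two halves of the bracket,
  and dividing one by the other is subtraction to this order.\<close>

lemma bch_commutator_approx:
  assumes x: "x \<in> F 1" and y: "y \<in> F 1" and xy: "\<lbrace>x, y\<rbrace> \<in> F m"
  shows "bch c (bch c x y) (- bch c y x) - \<lbrace>x, y\<rbrace> \<in> F (Suc m)"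
proof -
  let ?v = "bch c x y" and ?u = "bch c y x"
  have v: "?v \<in> F 1" and u: "?u \<in> F 1" using x y bch_in_F by auto
  have yx: "\<lbrace>y, x\<rbrace> = - \<lbrace>x, y\<rbrace>" by (rule bracket_antisym)
  have d: "?v - ?u - \<lbrace>x, y\<rbrace> \<in> F (Suc m)"
  proof (cases "c \<ge> 2")
    case True
    then have two: "(2 :: 'k) \<noteq> 0" using of_nat_nonzero[of 2] by simp
    have "?v - (x + y + inverse 2 *s \<lbrace>x, y\<rbrace>) - (?u - (y + x + inverse 2 *s \<lbrace>y, x\<rbrace>)) \<in> F (Suc m)"
      using bch_approx_bracket[OF x y xy True] bch_approx_bracket[OF y x _ True] F_neg[OF xy] yx F_diff
      by metis
    moreover have "inverse 2 *s \<lbrace>x, y\<rbrace> + inverse 2 *s \<lbrace>x, y\<rbrace> = \<lbrace>x, y\<rbrace>"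
      using two by (simp flip: scale_left_distrib)
    ultimately show ?thesis unfolding yx by (simp add: algebra_simps)
  next
    \<comment> \<open>Here 2 may fail to be invertible, but the bracket itself is 0.\<close>
    case False
    then have "\<lbrace>x, y\<rbrace> = 0" using F_vanish[OF F_bracket[OF x y]] by simp
    then show ?thesis using bch_commuting[OF x y] bch_commuting[OF y x] yx by (simp add: add.commute)
  qed
  have "?v - ?u \<in> F m"
    using F_add[OF F_weaken[OF d, of m] xy] by simp
  then have "\<lbrace>- ?u, ?v - ?u\<rbrace> \<in> F (Suc m)" using F_bracket_left[OF F_neg[OF u]] by simp
  \<comment> \<open>\<open>?u\<close> commutes with itself, so only the small difference
    \<open>?v - ?u\<close> matters in the bracket with \<open>?v\<close>.\<close>
  moreover have "\<lbrace>- ?u, ?v - ?u\<rbrace> = \<lbrace>?v, ?u\<rbrace>"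
    using bracket_antisym[of ?u ?v]
    by (simp add: bracket_diff_right bracket_minus_left bracket_self)
  ultimately have "\<lbrace>?v, - ?u\<rbrace> \<in> F (Suc m)" using F_neg by (simp add: bracket_minus_right)
  from F_add[OF bch_approx_add[OF v F_neg[OF u] this] d] show ?thesis by (simp add: algebra_simps)
qed

text \<open>
  Successive approximation: group commutators in \<open>H\<close> realise nested brackets modulo higher weight,
  so every element of \<open>F n\<close> is congruent to one of \<open>H\<close> modulo \<open>F (n + 1)\<close>.
\<close>

lemma bch_closed_contains_F_1:
  assumes scalars: "\<And>r :: 'k. \<exists>k. r = of_nat k"
    and HF: "H \<subseteq> F 1" and H0: "0 \<in> H"
    and H_bch: "\<And>x y. x \<in> H \<Longrightarrow> y \<in> H \<Longrightarrow> bch c x y \<in> H"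
    and H_neg: "\<And>x. x \<in> H \<Longrightarrow> - x \<in> H"
    and gen: "\<And>n. F (Suc n) \<subseteq> span {nested_bracket ws | ws. set ws \<subseteq> H \<and> length ws \<ge> Suc n}"
  shows "F 1 \<subseteq> H"
proof
  \<comment> \<open>Powers of \<open>h\<close> in the group are its integer multiples, and every
    scalar is such a multiple.\<close>
  have H_scale: "r *s h \<in> H" if h: "h \<in> H" for r h
  proof -
    have "of_nat k *s h \<in> H" for k
    proof (induction k)
      case (Suc k)
      have "bch c (of_nat k *s h) h = of_nat k *s h + h"
        using HF h by (intro bch_commuting F_scale) (auto simp: bracket_scale_left bracket_self)
      then show ?case using H_bch[OF Suc h] by (simp add: scale_left_distrib add.commute)
    qed (simp add: H0)
    then show ?thesis using scalars[of r] by auto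
  qed
  \<comment> \<open>By induction on the word: approximate the inner bracket by an element of
    \<open>H\<close> and take its group commutator with the first letter.\<close>
  have nested: "\<exists>h\<in>H. h - nested_bracket ws \<in> F (Suc (length ws))" if "set ws \<subseteq> H" for ws
    using that
  proof (induction ws rule: nested_bracket.induct)
    case 1
    then show ?case using H0 by auto
  next
    case (2 x)
    then show ?case by (auto intro!: bexI[of _ x])
  next
    case (3 x y zs)
    let ?u = "nested_bracket (y # zs)" and ?n = "length (y # zs)"
    obtain h where h: "h \<in> H" and hu: "h - ?u \<in> F (Suc ?n)" using 3 by auto
    have x: "x \<in> H" "x \<in> F 1" and h1: "h \<in> F 1" using 3 h HF by auto
    have "?u \<in> F ?n" using 3 HF by (intro nested_bracket_in_F) auto
    then have "h \<in> F ?n" using F_add[OF F_weaken[OF hu, of ?n]] by fastforce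
    then have "bch c (bch c x h) (- bch c h x) - \<lbrace>x, h\<rbrace> \<in> F (Suc (Suc ?n))"
      by (intro bch_commutator_approx F_bracket_left x h1)
    moreover have "\<lbrace>x, h\<rbrace> - \<lbrace>x, ?u\<rbrace> \<in> F (Suc (Suc ?n))"
      using F_bracket_left[OF x(2) hu] by (simp add: bracket_diff_right)
    ultimately have "bch c (bch c x h) (- bch c h x) - \<lbrace>x, ?u\<rbrace> \<in> F (Suc (Suc ?n))"
      using F_add by fastforce
    moreover have "bch c (bch c x h) (- bch c h x) \<in> H" using H_bch H_neg x h by blast
    ultimately show ?case by auto
  qed
  have approx: "\<exists>h\<in>H. h - z \<in> F (Suc (Suc n))" if "z \<in> F (Suc n)" for z n
  proof -
    \<comment> \<open>Requiring \<open>h\<close> to lie in \<open>F (Suc n)\<close> makes brackets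
      of two such elements fall into the next level, so that products approximate sums and
      \<open>?Q\<close> is a subspace.\<close>
    let ?Q = "{z. \<exists>h\<in>H. h \<in> F (Suc n) \<and> h - z \<in> F (Suc (Suc n))}"
    have "z \<in> ?Q" if "z \<in> span {nested_bracket ws | ws. set ws \<subseteq> H \<and> length ws \<ge> Suc n}"
      using that
    proof (induction rule: span_induct)
      case base
      show ?case unfolding Collect_mem_eq
      proof (rule subspaceI)
        show "0 \<in> ?Q" using H0 by auto
      next
        fix u v assume "u \<in> ?Q" "v \<in> ?Q"
        then obtain h k where h: "h \<in> H" "h \<in> F (Suc n)" "h - u \<in> F (Suc (Suc n))"
          and k: "k \<in> H" "k \<in> F (Suc n)" "k - v \<in> F (Suc (Suc n))" by blast
        have "\<lbrace>h, k\<rbrace> \<in> F (Suc (Suc n))" using F_weaken[OF F_bracket[OF h(2) k(2)]] by simp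
        then have "bch c h k - (h + k) \<in> F (Suc (Suc n))" using h k HF by (intro bch_approx_add) auto
        then have "bch c h k - (h + k) + ((h - u) + (k - v)) \<in> F (Suc (Suc n))"
          using h k F_add by blast
        then have A: "bch c h k - (u + v) \<in> F (Suc (Suc n))" by (simp add: algebra_simps)
        have "bch c h k - (h + k) + (h + k) \<in> F (Suc n)"
          using F_add[OF F_weaken[OF \<open>bch c h k - (h + k) \<in> F (Suc (Suc n))\<close>] F_add[OF h(2) k(2)]]
          by simp
        then show "u + v \<in> ?Q" using A H_bch[OF h(1) k(1)] by auto
      next
        fix r u assume "u \<in> ?Q"
        then obtain h where h: "h \<in> H" "h \<in> F (Suc n)" "h - u \<in> F (Suc (Suc n))" by blast
        then have "r *s h - r *s u \<in> F (Suc (Suc n))"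
          using F_scale[of "h - u" "Suc (Suc n)" r] by (simp add: scale_right_diff_distrib)
        then show "r *s u \<in> ?Q" using H_scale h F_scale by blast
      qed
    next
      case (step u)
      then obtain ws where ws: "u = nested_bracket ws" "set ws \<subseteq> H" "length ws \<ge> Suc n" by auto
      have u: "u \<in> F (length ws)" unfolding ws(1) using ws HF by (intro nested_bracket_in_F) auto
      show ?case
      proof (cases "length ws = Suc n")
        case True
        obtain h where h: "h \<in> H" "h - u \<in> F (Suc (Suc n))" using nested[OF ws(2)] True ws(1) by auto
        then have "(h - u) + u \<in> F (Suc n)"
          using u True F_weaken[OF h(2), of "Suc n"] by (intro F_add) simp_all
        then show ?thesis using h by auto
      next
        case False
        then have "u \<in> F (Suc (Suc n))" using F_weaken[OF u] ws(3) by simp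
        then show ?thesis using H0 F_neg by auto
      qed
    qed
    then show ?thesis using gen that by blast
  qed
  fix z assume z: "z \<in> F 1"
  \<comment> \<open>Multiplying on the left by inverses of elements of \<open>H\<close> pushes
    \<open>z\<close> down the filtration. At \<open>n = c\<close> the quotient is trivial, so
    \<open>z\<close> equals an element of \<open>H\<close>.\<close>
  have "\<exists>h\<in>H. bch c (- h) z \<in> F (Suc n)" for n
  proof (induction n)
    case 0
    then show ?case using H0 z bch_in_F[of 0 z] by force
  next
    case (Suc n)
    then obtain h where h: "h \<in> H" "bch c (- h) z \<in> F (Suc n)" by blast
    let ?z = "bch c (- h) z"
    obtain k where k: "k \<in> H" "k - ?z \<in> F (Suc (Suc n))" using approx[OF h(2)] by blast
    have h1: "- h \<in> F 1" and k1: "- k \<in> F 1" and z1: "?z \<in> F 1"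
      using h k HF H_neg F_weaken[OF h(2)] by auto
    have kz: "?z - k \<in> F (Suc (Suc n))" using F_neg[OF k(2)] by simp
    have "\<lbrace>- k, ?z - k\<rbrace> \<in> F (Suc (Suc n))" using F_weaken[OF F_bracket_left[OF k1 kz]] by simp
    then have "\<lbrace>- k, ?z\<rbrace> \<in> F (Suc (Suc n))"
      by (simp add: bracket_diff_right bracket_minus_left bracket_self)
    from F_add[OF bch_approx_add[OF k1 z1 this] kz] have "bch c (- k) ?z \<in> F (Suc (Suc n))" by simp
    then have "bch c (bch c (- k) (- h)) z \<in> F (Suc (Suc n))"
      using bch_assoc[OF k1 h1 z] by simp
    moreover have "- bch c (- k) (- h) \<in> H" using H_bch H_neg h k by blast
    ultimately show ?case by (metis minus_minus)
  qed
  from this[of c] obtain h where h: "h \<in> H" "bch c (- h) z = 0" using F_Suc_c by auto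
  have h1: "h \<in> F 1" "- h \<in> F 1" using h HF H_neg by auto
  have "h = bch c h 0" using bch_commuting[OF h1(1) F_zero] by simp
  also have "\<dots> = bch c (bch c h (- h)) z" using bch_assoc[OF h1 z] h by simp
  also have "bch c h (- h) = 0"
    using bch_commuting[OF h1] by (simp add: bracket_minus_right bracket_self)
  also have "bch c 0 z = z" using bch_commuting[OF F_zero z] by simp
  finally show "z \<in> H" using h by simp
qed

end

section \<open>The Lazard group\<close>

text \<open>The fibre of multiplication over \<open>h0 \<otimes> k0\<close> is parametrised by
  \<open>t\<close> in \<open>H \<inter> K\<close> via the pair of \<open>h0 \<otimes> t\<close> and
  \<open>inv t \<otimes> k0\<close>.\<close>

lemma (in group) card_set_mult:
  assumes H: "subgroup H G" and K: "subgroup K G" and fin: "finite (carrier G)"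
  shows "card (H <#> K) * card (H \<inter> K) = card H * card K"
proof -
  interpret H: subgroup H G by (rule H)
  interpret K: subgroup K G by (rule K)
  let ?f = "\<lambda>(h, k). h \<otimes> k"
  have finHK: "finite (H \<times> K)"
    using fin H.subset K.subset finite_subset by blast
  have img: "?f ` (H \<times> K) = H <#> K" by (force simp: set_mult_def)
  have fiber: "card {p \<in> H \<times> K. ?f p = g} = card (H \<inter> K)" if g: "g \<in> H <#> K" for g
  proof -
    obtain h0 k0 where hk: "h0 \<in> H" "k0 \<in> K" "g = h0 \<otimes> k0"
      using g unfolding set_mult_def by blast
    note [simp] = H.mem_carrier K.mem_carrier
    have "bij_betw (\<lambda>t. (h0 \<otimes> t, inv t \<otimes> k0)) (H \<inter> K) {p \<in> H \<times> K. ?f p = g}"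
    proof (rule bij_betwI[where g = "\<lambda>(h, k). inv h0 \<otimes> h"])
      show "(\<lambda>t. (h0 \<otimes> t, inv t \<otimes> k0)) \<in> H \<inter> K \<rightarrow> {p \<in> H \<times> K. ?f p = g}"
      proof (clarsimp simp: hk)
        fix t assume "t \<in> H" "t \<in> K"
        then show "h0 \<otimes> t \<otimes> (inv t \<otimes> k0) = h0 \<otimes> k0"
          using hk by (simp add: m_assoc) (simp flip: m_assoc)
      qed
      show "(\<lambda>(h, k). inv h0 \<otimes> h) \<in> {p \<in> H \<times> K. ?f p = g} \<rightarrow> H \<inter> K"
      proof (clarsimp simp: hk)
        fix h k assume hk': "h \<in> H" "k \<in> K" "h \<otimes> k = h0 \<otimes> k0"
        have "inv h0 \<otimes> h = inv h0 \<otimes> (h \<otimes> k) \<otimes> inv k"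
          using hk hk'(1,2) by (simp add: m_assoc)
        also have "\<dots> = k0 \<otimes> inv k"
          unfolding hk'(3) using hk hk'(1,2) by (simp flip: m_assoc)
        finally show "inv h0 \<otimes> h \<in> K" using hk hk' by simp
      qed
      show "(case (h0 \<otimes> t, inv t \<otimes> k0) of (h, k) \<Rightarrow> inv h0 \<otimes> h) = t" if "t \<in> H \<inter> K" for t
        using that hk by (simp flip: m_assoc)
      show "(h0 \<otimes> (case p of (h, k) \<Rightarrow> inv h0 \<otimes> h), inv (case p of (h, k) \<Rightarrow> inv h0 \<otimes> h) \<otimes> k0) = p"
        if "p \<in> {p \<in> H \<times> K. ?f p = g}" for p
      proof -
        obtain h k where p: "p = (h, k)" "h \<in> H" "k \<in> K" "h \<otimes> k = h0 \<otimes> k0"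
          using \<open>p \<in> _\<close> hk by auto
        have "inv h \<otimes> (h0 \<otimes> k0) = k" using p(2,3) by (simp flip: p(4) m_assoc)
        then show ?thesis using p(1-3) hk by (simp add: inv_mult_group m_assoc) (simp flip: m_assoc)
      qed
    qed
    then show ?thesis by (simp add: bij_betw_same_card)
  qed
  have "card H * card K = (\<Sum>p\<in>H \<times> K. 1)" by (simp add: card_cartesian_product)
  also have "\<dots> = (\<Sum>g\<in>?f ` (H \<times> K). \<Sum>p\<in>{p \<in> H \<times> K. ?f p = g}. 1)"
    by (rule sum.image_gen[OF finHK])
  also have "\<dots> = card (H <#> K) * card (H \<inter> K)"
    unfolding img using fiber by simp
  finally show ?thesis by simp
qed

lemma (in group) subgroup_set_mult_commute:
  assumes H: "subgroup H G" and K: "subgroup K G" and comm: "H <#> K = K <#> H"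
  shows "subgroup (H <#> K) G"
proof (rule subgroupI)
  interpret H: subgroup H G by (rule H)
  interpret K: subgroup K G by (rule K)
  note [simp] = H.mem_carrier K.mem_carrier
  show "H <#> K \<subseteq> carrier G" by (auto simp: set_mult_def)
  have "\<one> \<otimes> \<one> \<in> H <#> K" using H.one_closed K.one_closed unfolding set_mult_def by blast
  then show "H <#> K \<noteq> {}" by blast
  show "inv a \<in> H <#> K" if a: "a \<in> H <#> K" for a
  proof -
    obtain h k where "h \<in> H" "k \<in> K" "a = h \<otimes> k" using a unfolding set_mult_def by blast
    then have "inv a \<in> K <#> H" by (auto simp: set_mult_def inv_mult_group)
    then show ?thesis by (simp add: comm)
  qed
  fix a b assume a: "a \<in> H <#> K" and b: "b \<in> H <#> K"
  obtain h k where hk: "h \<in> H" "k \<in> K" "a = h \<otimes> k" using a unfolding set_mult_def by blast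
  obtain h' k' where hk': "h' \<in> H" "k' \<in> K" "b = h' \<otimes> k'" using b unfolding set_mult_def by blast
  have "k \<otimes> h' \<in> H <#> K" unfolding comm using hk hk' by (auto simp: set_mult_def)
  then obtain h'' k'' where hk'': "h'' \<in> H" "k'' \<in> K" "k \<otimes> h' = h'' \<otimes> k''"
    unfolding set_mult_def by blast
  have "a \<otimes> b = h \<otimes> (k \<otimes> h') \<otimes> k'" using hk hk' by (simp add: m_assoc)
  also have "\<dots> = (h \<otimes> h'') \<otimes> (k'' \<otimes> k')" unfolding hk''(3) using hk hk' hk'' by (simp add: m_assoc)
  finally have "a \<otimes> b = (h \<otimes> h'') \<otimes> (k'' \<otimes> k')" .
  then show "a \<otimes> b \<in> H <#> K" using hk hk' hk'' by (auto simp: set_mult_def)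
qed

section \<open>Fields with a prime number of elements, and finiteness\<close>

lemma CHAR_eq_prime_CARD:
  assumes "prime p" and "CARD('k::field) = p"
  shows "CHAR('k) = p"
  using CHAR_dvd_CARD[where 'a = 'k] assms CHAR_not_1[where 'a = 'k] by (auto simp: prime_nat_iff)

text \<open>The first \<open>p\<close> multiples of 1 are distinct and hence exhaust the field. This
  is why closure under addition gives closure under scalars.\<close>

lemma prime_field_eq_of_nat:
  fixes r :: "'k::field"
  assumes "prime p" and "CARD('k) = p"
  shows "\<exists>k. r = of_nat k"
proof -
  have fin: "finite (UNIV :: 'k set)"
    using assms by (intro card_ge_0_finite) (simp add: prime_gt_0_nat)
  have "inj_on (of_nat :: nat \<Rightarrow> 'k) {..<p}"
  proof (rule linorder_inj_onI')
    fix i j assume ij: "i \<in> {..<p}" "j \<in> {..<p}" "i < j"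
    have "\<not> p dvd j - i" using ij by (auto dest: dvd_imp_le)
    then have "(of_nat (j - i) :: 'k) \<noteq> 0"
      by (simp only: of_nat_eq_0_iff_char_dvd CHAR_eq_prime_CARD[OF assms] not_False_eq_True)
    then show "(of_nat i :: 'k) \<noteq> of_nat j" using ij by (simp add: of_nat_diff)
  qed
  then have "of_nat ` {..<p} = (UNIV :: 'k set)"
    using assms fin by (intro card_subset_eq) (simp_all add: card_image)
  then show ?thesis by (metis UNIV_I imageE)
qed

lemma finite_UNIV_finite_dimensional:
  fixes scale :: "'k::field \<Rightarrow> 'l::ab_group_add \<Rightarrow> 'l"
  assumes "finite_dimensional_vector_space scale Basis" and fin: "finite (UNIV :: 'k set)"
  shows "finite (UNIV :: 'l set)"
proof -
  interpret finite_dimensional_vector_space scale Basis by (rule assms)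
  let ?g = "\<lambda>u. \<Sum>v\<in>Basis. scale (u v) v"
  have "UNIV \<subseteq> ?g ` (Basis \<rightarrow>\<^sub>E UNIV)"
  proof
    fix z :: 'l
    obtain u where u: "z = ?g u"
      using span_finite[OF finite_Basis] span_Basis by auto
    then show "z \<in> ?g ` (Basis \<rightarrow>\<^sub>E UNIV)"
      by (intro image_eqI[of _ _ "restrict u Basis"]) auto
  qed
  moreover have "finite (Basis \<rightarrow>\<^sub>E (UNIV :: 'k set))"
    using finite_Basis fin by (intro finite_PiE)
  ultimately show ?thesis by (meson finite_imageI finite_subset)
qed

section \<open>The filtration generated by a subset\<close>

context lie_algebra
begin

text \<open>
  The lower central series of the Lie subalgebra generated by \<open>H\<close>, as a filtration inside the
  ambient Lie algebra; \<open>H = UNIV\<close> gives the lower central series itself.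
\<close>

definition weight_span :: "'l set \<Rightarrow> nat \<Rightarrow> 'l set" where
  "weight_span H n = span {nested_bracket ws | ws. set ws \<subseteq> H \<and> length ws \<ge> n}"

lemma nested_bracket_in_weight_span:
  "set ws \<subseteq> H \<Longrightarrow> n \<le> length ws \<Longrightarrow> nested_bracket ws \<in> weight_span H n"
  unfolding weight_span_def by (rule span_base) auto

lemma subspace_weight_span: "subspace (weight_span H n)"
  unfolding weight_span_def by (rule subspace_span)

lemma weight_span_antimono: "m \<le> n \<Longrightarrow> weight_span H n \<subseteq> weight_span H m"
  unfolding weight_span_def by (rule span_mono) auto

lemma weight_span_induct [consumes 1, case_names subspace nested]:
  assumes "z \<in> weight_span H n" and "subspace {z. P z}"
    and "\<And>ws. set ws \<subseteq> H \<Longrightarrow> n \<le> length ws \<Longrightarrow> P (nested_bracket ws)"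
  shows "P z"
  using assms unfolding weight_span_def by (auto intro: span_induct)

lemma subspace_bracket_right: "subspace S \<Longrightarrow> subspace {z. \<lbrace>a, z\<rbrace> \<in> S}"
  by (rule subspaceI) (auto simp: bracket_add_right bracket_scale_right
      intro: subspace_0 subspace_add subspace_scale)

lemma subspace_bracket_left: "subspace S \<Longrightarrow> subspace {z. \<lbrace>z, a\<rbrace> \<in> S}"
  by (rule subspaceI) (auto simp: bracket_add_left bracket_scale_left
      intro: subspace_0 subspace_add subspace_scale)

lemma bracket_generator_weight_span:
  assumes a: "a \<in> H" and z: "z \<in> weight_span H n"
  shows "\<lbrace>a, z\<rbrace> \<in> weight_span H (Suc n)"
  using z
proof (induction rule: weight_span_induct)
  case subspace
  show ?case by (rule subspace_bracket_right[OF subspace_weight_span])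
next
  case (nested ws)
  show ?case
  proof (cases ws)
    \<comment> \<open>The empty word stands for 0, so prepending \<open>a\<close> to it would give
      \<open>a\<close> and not the bracket.\<close>
    case Nil
    then show ?thesis using subspace_0[OF subspace_weight_span] by simp
  next
    case (Cons b bs)
    then show ?thesis
      using nested_bracket_in_weight_span[of "a # ws" H "Suc n"] a nested by simp
  qed
qed

text \<open>The Leibniz rule moves the letters of the left factor one at a time to the outside or
  onto \<open>z\<close>, which is why \<open>z\<close> and \<open>n\<close> vary in the
  induction.\<close>

lemma bracket_nested_weight_span:
  assumes "set us \<subseteq> H" "z \<in> weight_span H n"
  shows "\<lbrace>nested_bracket us, z\<rbrace> \<in> weight_span H (length us + n)"
  using assms
proof (induction us arbitrary: z n rule: nested_bracket.induct)
  case 1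
  then show ?case using subspace_0[OF subspace_weight_span] by simp
next
  case (2 x)
  then show ?case using bracket_generator_weight_span by simp
next
  case (3 x y zs)
  let ?u = "nested_bracket (y # zs)"
  have "\<lbrace>x, \<lbrace>?u, z\<rbrace>\<rbrace> \<in> weight_span H (length (x # y # zs) + n)"
    using bracket_generator_weight_span[OF _ "3.IH"[OF _ "3.prems"(2)], of x] "3.prems"(1) by simp
  moreover have "\<lbrace>?u, \<lbrace>x, z\<rbrace>\<rbrace> \<in> weight_span H (length (x # y # zs) + n)"
    using "3.IH"[OF _ bracket_generator_weight_span[OF _ "3.prems"(2)], of x] "3.prems"(1) by simp
  moreover have "\<lbrace>nested_bracket (x # y # zs), z\<rbrace> = \<lbrace>x, \<lbrace>?u, z\<rbrace>\<rbrace> - \<lbrace>?u, \<lbrace>x, z\<rbrace>\<rbrace>"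
    using bracket_leibniz[of x ?u z] by simp
  ultimately show ?case using subspace_diff[OF subspace_weight_span] by metis
qed

lemma bracket_weight_span:
  assumes "u \<in> weight_span H i" and z: "z \<in> weight_span H j"
  shows "\<lbrace>u, z\<rbrace> \<in> weight_span H (i + j)"
  using assms(1)
proof (induction rule: weight_span_induct)
  case subspace
  show ?case by (rule subspace_bracket_left[OF subspace_weight_span])
next
  case (nested ws)
  then show ?case
    using bracket_nested_weight_span[OF nested(1) z] weight_span_antimono[of "i + j" "length ws + j"]
    by auto
qed

lemma subspace_lower_central: "subspace (lower_central n)"
  by (cases n) (simp_all add: subspace_UNIV)

lemma lower_central_Suc_subset: "lower_central (Suc n) \<subseteq> lower_central n"
proof (induction n)
  case (Suc n)
  show ?case unfolding lower_central.simps(2)[of "Suc n"] lower_central.simps(2)[of n]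
    using Suc by (intro span_mono) auto
qed simp

lemma nested_bracket_in_lower_central:
  "nested_bracket ws \<in> lower_central (length ws - 1)"
proof (induction ws rule: nested_bracket.induct)
  case (3 x y zs)
  then show ?case by (auto intro: span_base)
qed auto

text \<open>The shift by one arises because \<open>lower_central 0\<close> already corresponds to
  weight 1.\<close>

lemma weight_span_subset_lower_central: "weight_span H (Suc n) \<subseteq> lower_central n"
  unfolding weight_span_def
proof (rule span_minimal[OF _ subspace_lower_central], clarify)
  fix ws :: "'l list" assume "Suc n \<le> length ws"
  then have "lower_central (length ws - 1) \<subseteq> lower_central n"
    using lift_Suc_antimono_le[of lower_central n "length ws - 1"] lower_central_Suc_subset by simp
  then show "nested_bracket ws \<in> lower_central n"
    using nested_bracket_in_lower_central by blast
qed

lemma filtered_weight_span: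
  assumes "lower_central c = {0}" and "\<And>n. 1 \<le> n \<Longrightarrow> n \<le> c \<Longrightarrow> (of_nat n :: 'k) \<noteq> 0"
  shows "filtered_lie_algebra scale bracket (weight_span H) c"
proof
  show "weight_span H (Suc c) = {0}"
    using weight_span_subset_lower_central[of H c] assms(1) subspace_0[OF subspace_weight_span] by blast
qed (use assms(2) in \<open>simp_all add: subspace_weight_span weight_span_antimono bracket_weight_span\<close>)

lemma subset_weight_span_1: "H \<subseteq> weight_span H 1"
proof
  fix h assume "h \<in> H"
  then show "h \<in> weight_span H 1" using nested_bracket_in_weight_span[of "[h]" H 1] by simp
qed

lemma lie_subalgebra_nested_bracket:
  assumes "lie_subalgebra A" "set ws \<subseteq> A"
  shows "nested_bracket ws \<in> A"
  using assms(2)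
  by (induction ws rule: nested_bracket.induct)
    (use assms(1) in \<open>auto simp: lie_subalgebra_def intro: subspace_0\<close>)

lemma lie_subalgebra_bch:
  assumes A: "lie_subalgebra A" and "x \<in> A" "y \<in> A"
  shows "bch c x y \<in> A"
proof -
  have "nested_bracket (bch_word x y ps) \<in> A" for ps
    using set_bch_word[of x y ps] assms by (intro lie_subalgebra_nested_bracket[OF A]) blast
  then show ?thesis
    using A unfolding bch_def bch_component_def lie_subalgebra_def
    by (intro subspace_sum subspace_scale) auto
qed

end

text \<open>The prime, the field and the dimension enter the argument through these
  consequences.\<close>

locale nilpotent_lie_algebra = lie_algebra scale bracket
  for scale :: "'k::field \<Rightarrow> 'l::ab_group_add \<Rightarrow> 'l" (infixr "*s" 75)
    and bracket :: "'l \<Rightarrow> 'l \<Rightarrow> 'l" ("\<lbrace>_,/ _\<rbrace>") +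
  fixes c :: nat
  assumes lower_central_c: "lower_central c = {0}"
    and class_eq: "nilpotency_class = c"
    and class_invertible: "1 \<le> n \<Longrightarrow> n \<le> c \<Longrightarrow> (of_nat n :: 'k) \<noteq> 0"
    and scalars: "\<exists>k. (r :: 'k) = of_nat k"
    and finite_carrier: "finite (UNIV :: 'l set)"
begin

lemma weight_span_UNIV: "x \<in> weight_span UNIV 1"
  using subset_weight_span_1 by blast

sublocale filtered_lie_algebra scale bracket "weight_span UNIV" c
  using lower_central_c class_invertible by (rule filtered_weight_span)

lemma lazard_simps [simp]:
  "carrier lazard_group = UNIV" "monoid.mult lazard_group = bch c" "one lazard_group = 0"
  by (simp_all add: lazard_group_def class_eq)

lemma bch_minus [simp]: "bch c x (- x) = 0" "bch c (- x) x = 0"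
  by (simp_all add: bch_commuting weight_span_UNIV bracket_minus_left bracket_minus_right bracket_self
      del: One_nat_def)

lemma lazard_group: "group lazard_group"
proof (rule groupI)
  show "\<exists>y\<in>carrier lazard_group. y \<otimes>\<^bsub>lazard_group\<^esub> x = \<one>\<^bsub>lazard_group\<^esub>" for x
    by (auto intro: exI[of _ "- x"])
qed (simp_all add: bch_assoc bch_commuting weight_span_UNIV del: One_nat_def)

interpretation lazard: group lazard_group by (rule lazard_group)

lemma lazard_inv [simp]: "inv\<^bsub>lazard_group\<^esub> x = - x"
  by (rule lazard.inv_equality) simp_all

lemma lie_subalgebra_imp_subgroup:
  assumes "lie_subalgebra A"
  shows "subgroup A lazard_group"
proof (rule lazard.subgroupI)
  have "subspace A" using assms by (simp add: lie_subalgebra_def)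
  then show "A \<noteq> {}" "\<And>a. a \<in> A \<Longrightarrow> inv\<^bsub>lazard_group\<^esub> a \<in> A"
    using subspace_0 subspace_neg by auto
qed (simp_all add: lie_subalgebra_bch[OF assms])

text \<open>With the filtration generated by \<open>H\<close> itself, successive approximation gives
  \<open>H = weight_span H 1\<close>, which is visibly a subspace closed under brackets.\<close>

lemma subgroup_imp_lie_subalgebra:
  assumes "subgroup H lazard_group"
  shows "lie_subalgebra H"
proof -
  interpret H: subgroup H lazard_group by (rule assms)
  interpret W: filtered_lie_algebra scale bracket "weight_span H" c
    using lower_central_c class_invertible by (rule filtered_weight_span)
  have "weight_span H 1 \<subseteq> H"
  proof (rule W.bch_closed_contains_F_1[OF scalars subset_weight_span_1])
    show "0 \<in> H" "\<And>x y. x \<in> H \<Longrightarrow> y \<in> H \<Longrightarrow> bch c x y \<in> H" "\<And>x. x \<in> H \<Longrightarrow> - x \<in> H"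
      using H.one_closed H.m_closed H.m_inv_closed by auto
    show "weight_span H (Suc n) \<subseteq> span {nested_bracket ws | ws. set ws \<subseteq> H \<and> Suc n \<le> length ws}" for n
      by (simp add: weight_span_def)
  qed
  then have eq: "weight_span H 1 = H" using subset_weight_span_1 by blast
  have "\<lbrace>x, y\<rbrace> \<in> weight_span H 1" if "x \<in> weight_span H 1" "y \<in> weight_span H 1" for x y
    using bracket_weight_span[OF that] weight_span_antimono[of 1 "1 + 1" H] by auto
  then show ?thesis
    using subspace_weight_span[of H 1] by (simp add: eq lie_subalgebra_def del: One_nat_def)
qed

lemma subgroup_lazard_iff: "subgroup H lazard_group \<longleftrightarrow> lie_subalgebra H"
  using subgroup_imp_lie_subalgebra lie_subalgebra_imp_subgroup by blast

text \<open>Introduced so that the counting formula for products of subgroups also counts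
  \<open>A + B\<close>.\<close>

definition additive_group :: "'l monoid" where
  "additive_group = \<lparr>carrier = UNIV, monoid.mult = (+), one = 0\<rparr>"

lemma additive_group: "group additive_group"
  by (rule groupI) (auto simp: additive_group_def add.assoc intro: exI[of _ "- _"])

interpretation additive: group additive_group by (rule additive_group)

lemma subspace_imp_additive_subgroup:
  assumes "subspace A"
  shows "subgroup A additive_group"
proof (rule additive.subgroupI)
  fix a assume "a \<in> A"
  moreover have "inv\<^bsub>additive_group\<^esub> a = - a"
    by (rule additive.inv_equality) (simp_all add: additive_group_def)
  ultimately show "inv\<^bsub>additive_group\<^esub> a \<in> A" using assms by (simp add: subspace_neg)
qed (use assms subspace_0 in \<open>auto simp: additive_group_def subspace_add\<close>)

lemma card_set_mult_eq_card_sum: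
  assumes A: "lie_subalgebra A" and B: "lie_subalgebra B"
  shows "card (A <#>\<^bsub>lazard_group\<^esub> B) = card {a + b | a b. a \<in> A \<and> b \<in> B}"
proof -
  have sub: "subspace A" "subspace B" using A B by (auto simp: lie_subalgebra_def)
  have "A <#>\<^bsub>additive_group\<^esub> B = {a + b | a b. a \<in> A \<and> b \<in> B}"
    by (auto simp: set_mult_def additive_group_def)
  then have "card A * card B = card {a + b | a b. a \<in> A \<and> b \<in> B} * card (A \<inter> B)"
    using additive.card_set_mult[of A B] sub finite_carrier
    by (simp add: subspace_imp_additive_subgroup) (simp add: additive_group_def)
  moreover have "card (A <#>\<^bsub>lazard_group\<^esub> B) * card (A \<inter> B) = card A * card B"
    using lazard.card_set_mult[of A B] A B finite_carrier by (simp add: subgroup_lazard_iff)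
  moreover have "card (A \<inter> B) \<noteq> 0"
    using sub subspace_0 finite_subset[OF subset_UNIV finite_carrier] by (auto simp: card_eq_0_iff)
  ultimately show ?thesis by simp
qed

text \<open>A bracket of two sums splits into four brackets; the mixed ones lie in \<open>S\<close>
  by the inclusion, up to sign, and the others because \<open>A\<close> and \<open>B\<close> are
  subalgebras.\<close>

lemma lie_subalgebra_sum_iff:
  assumes A: "lie_subalgebra A" and B: "lie_subalgebra B"
  defines "S \<equiv> {a + b | a b. a \<in> A \<and> b \<in> B}"
  shows "lie_subalgebra S \<longleftrightarrow> bracket_subalgebra A B \<subseteq> S"
proof
  have sub: "subspace A" "subspace B" using A B by (auto simp: lie_subalgebra_def)
  have AS: "A \<subseteq> S" and BS: "B \<subseteq> S"
    unfolding S_def using subspace_0[OF sub(1)] subspace_0[OF sub(2)] by (force intro: exI[of _ 0])+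
  have S: "subspace S" unfolding S_def using subspace_sums[OF sub] .
  {
    assume L: "lie_subalgebra S"
    then have "{\<lbrace>a, b\<rbrace> | a b. a \<in> A \<and> b \<in> B} \<subseteq> S"
      using AS BS unfolding lie_subalgebra_def by blast
    with L show "bracket_subalgebra A B \<subseteq> S" unfolding bracket_subalgebra_def by blast
  next
    assume sub: "bracket_subalgebra A B \<subseteq> S"
    have AB: "\<lbrace>a, b\<rbrace> \<in> S" if "a \<in> A" "b \<in> B" for a b
      using that sub unfolding bracket_subalgebra_def by blast
    have "\<lbrace>x, y\<rbrace> \<in> S" if xy: "x \<in> S" "y \<in> S" for x y
    proof -
      obtain a b a' b' where x: "x = a + b" "a \<in> A" "b \<in> B" and y: "y = a' + b'" "a' \<in> A" "b' \<in> B"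
        using xy unfolding S_def by blast
      have "\<lbrace>a, a'\<rbrace> \<in> S" "\<lbrace>b, b'\<rbrace> \<in> S"
        using A B x y AS BS unfolding lie_subalgebra_def by blast+
      moreover have "\<lbrace>a, b'\<rbrace> \<in> S" using AB x y by blast
      moreover have "\<lbrace>b, a'\<rbrace> \<in> S"
        using subspace_neg[OF S AB[OF y(2) x(3)]] by (simp flip: bracket_antisym[of b a'])
      ultimately have "\<lbrace>a, a'\<rbrace> + \<lbrace>a, b'\<rbrace> + (\<lbrace>b, a'\<rbrace> + \<lbrace>b, b'\<rbrace>) \<in> S"
        using subspace_add[OF S] by blast
      then show ?thesis by (simp add: x y bracket_add_left bracket_add_right add_ac)
    qed
    then show "lie_subalgebra S" using S by (simp add: lie_subalgebra_def)
  }
qed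

text \<open>Both products have as many elements as the sum, so one inclusion suffices for equality.
  If they agree, the product is a subgroup, hence a subalgebra, and contains the sum; conversely, a
  sum that is a subalgebra is a subgroup and contains both products.\<close>

lemma set_mult_commute_iff:
  assumes A: "lie_subalgebra A" and B: "lie_subalgebra B"
  shows "A <#>\<^bsub>lazard_group\<^esub> B = B <#>\<^bsub>lazard_group\<^esub> A
    \<longleftrightarrow> lie_subalgebra {a + b | a b. a \<in> A \<and> b \<in> B}" (is "?AB = ?BA \<longleftrightarrow> lie_subalgebra ?S")
proof
  have fin: "finite M" for M :: "'l set" using finite_subset[OF subset_UNIV finite_carrier] .
  have z: "0 \<in> A" "0 \<in> B" using A B subspace_0 by (auto simp: lie_subalgebra_def)
  have bch0: "bch c x 0 = x" "bch c 0 x = x" for x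
    by (simp_all add: bch_commuting weight_span_UNIV del: One_nat_def)
  have "?S = {a + b | a b. a \<in> B \<and> b \<in> A}" by (auto simp: add.commute) (metis add.commute)+
  then have card: "card ?AB = card ?S" "card ?BA = card ?S"
    using card_set_mult_eq_card_sum[OF A B] card_set_mult_eq_card_sum[OF B A] by simp_all
  {
    assume "?AB = ?BA"
    then have L: "lie_subalgebra ?AB"
      using lazard.subgroup_set_mult_commute[of A B] A B by (simp add: subgroup_lazard_iff)
    have "bch c a b \<in> ?AB" if "a \<in> A" "b \<in> B" for a b
      unfolding set_mult_def lazard_simps using that by blast
    then have "A \<subseteq> ?AB" "B \<subseteq> ?AB"
      using z bch0 by (metis subsetI)+
    then have "?S \<subseteq> ?AB" using L subspace_add unfolding lie_subalgebra_def by blast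
    then have "?S = ?AB" using card fin by (intro card_subset_eq) simp_all
    then show "lie_subalgebra ?S" using L by simp
  next
    assume L: "lie_subalgebra ?S"
    have AS: "A \<subseteq> ?S" and BS: "B \<subseteq> ?S" using z by (force intro: exI[of _ 0])+
    have SS: "?S <#>\<^bsub>lazard_group\<^esub> ?S = ?S"
      using L by (intro lazard.subgroup_mult_id lie_subalgebra_imp_subgroup)
    have "?AB \<subseteq> ?S" "?BA \<subseteq> ?S"
      using mono_set_mult[OF AS BS, where G = lazard_group] mono_set_mult[OF BS AS, where G = lazard_group]
      unfolding SS by blast+
    then have "?AB = ?S" "?BA = ?S" using card_subset_eq[OF fin] card by simp_all
    then show "?AB = ?BA" by simp
  }
qed

theorem commutativity_degrees_eq:
  "subalgebra_commutativity_degree = subgroup_commutativity_degree lazard_group"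
proof -
  have "lie_subalgebra A \<and> lie_subalgebra B \<and>
          bracket_subalgebra A B \<subseteq> {a + b | a b. a \<in> A \<and> b \<in> B}
      \<longleftrightarrow> lie_subalgebra A \<and> lie_subalgebra B \<and>
          A <#>\<^bsub>lazard_group\<^esub> B = B <#>\<^bsub>lazard_group\<^esub> A" for A B
    using lie_subalgebra_sum_iff[of A B] set_mult_commute_iff[of A B] by blast
  then show ?thesis
    by (simp add: subalgebra_commutativity_degree_def subgroup_commutativity_degree_def subgroup_lazard_iff)
qed

end

theorem theorem1p4:
  fixes scale :: "'k::field \<Rightarrow> 'l::ab_group_add \<Rightarrow> 'l"
    and bracket :: "'l \<Rightarrow> 'l \<Rightarrow> 'l"
    and p c :: nat
  assumes "prime p" and "p \<ge> 3"
    and "CARD('k) = p"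
    and "lie_algebra scale bracket"
    and "\<exists>Basis. finite_dimensional_vector_space scale Basis"
    and "lie_algebra.nilpotent scale bracket"
    and "lie_algebra.nilpotency_class scale bracket = c" and "c < p"
  shows "lie_algebra.subalgebra_commutativity_degree scale bracket =
         subgroup_commutativity_degree (lie_algebra.lazard_group scale bracket)"
proof -
  interpret lie_algebra scale bracket by (rule assms)
  have "nilpotent_lie_algebra scale bracket c"
  proof
    have "lower_central nilpotency_class = {0}"
      unfolding nilpotency_class_def using assms(6)[unfolded nilpotent_def] by (rule LeastI_ex)
    then show "lower_central c = {0}" by (simp add: assms(7))
    show "nilpotency_class = c" by (rule assms)
    show "(of_nat n :: 'k) \<noteq> 0" if "1 \<le> n" "n \<le> c" for n
      using that \<open>c < p\<close>
      by (auto simp: of_nat_eq_0_iff_char_dvd CHAR_eq_prime_CARD[OF assms(1,3)] dest: dvd_imp_le)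
    show "\<exists>k. r = of_nat k" for r :: 'k
      by (rule prime_field_eq_of_nat[OF assms(1,3)])
    have "finite (UNIV :: 'k set)"
      using assms(1,3) by (intro card_ge_0_finite) (simp add: prime_gt_0_nat)
    then show "finite (UNIV :: 'l set)"
      using assms(5) finite_UNIV_finite_dimensional by blast
  qed
  then show ?thesis by (rule nilpotent_lie_algebra.commutativity_degrees_eq)
qed

end
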